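(* Let $n\ge 3$ and $k\ge 1$. Let $\theta,\zeta_1,\dots,\zeta_k$ be the automorphisms of $UV_n(k)$ given by $\theta(\rho_i)=\rho_i$, $\theta(\sigma_{i,t})=\sigma_{i,t}^{-1}$ for all $i,t$, and $\zeta_\ell(\rho_i)=\rho_i$, $\zeta_\ell(\sigma_{i,\ell})=\rho_i\sigma_{i,\ell}\rho_i$, $\zeta_\ell(\sigma_{i,t})=\sigma_{i,t}$ for $t\neq\ell$. Let $q\colon UV_n(k)\to M_kVB_n$ be the quotient map onto the multi-virtual braid group. Then $\theta,\zeta_1,\dots,\zeta_k$ descend along $q$ to commuting involutive automorphisms of $M_kVB_n$. Moreover, the automorphisms of $M_kVB_n$ induced by $\theta$ and $\zeta_k$ generate a subgroup of $\operatorname{Out}(M_kVB_n)$ isomorphic to $\mathbb{Z}_2\times\mathbb{Z}_2$.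
   Context: The universal virtual braid group $UV_n(k)$ is the group with generators $\rho_i,\sigma_{i,t}$ ($1\le i\le n-1$, $1\le t\le k$) and defining relations: (1) $\rho_i^2=1$; $\rho_i\rho_{i+1}\rho_i=\rho_{i+1}\rho_i\rho_{i+1}$ for $1\le i\le n-2$; $\rho_i\rho_j=\rho_j\rho_i$ for $|i-j|\ge 2$; (2) $\sigma_{i,t}\sigma_{j,\ell}=\sigma_{j,\ell}\sigma_{i,t}$ for $|i-j|\ge 2$ and all $1\le t,\ell\le k$; (3) $\sigma_{i,t}\rho_j=\rho_j\sigma_{i,t}$ for $|i-j|\ge 2$; (4) $\rho_i\rho_{i+1}\sigma_{i,t}=\sigma_{i+1,t}\rho_i\rho_{i+1}$ for $1\le i\le n-2$, $1\le t\le k$. The multi-virtual braid group $M_kVB_n$ has generators $\sigma_i$ and $\rho_i^{(\beta)}$ ($1\le i\le n-1$, $0\le\beta\le k-1$) and is the quotient of $UV_n(k)$ via $q(\rho_i)=\rho_i^{(0)}$, $q(\sigma_{i,t})=\rho_i^{(t)}$ for $1\le t\le k-1$, $q(\sigma_{i,k})=\sigma_i$, obtained by adding to the relations of $UV_n(k)$ (under this identification) the relations $(\rho_i^{(t)})^2=1$ and $\rho_i^{(t)}\rho_{i+1}^{(t)}\rho_i^{(t)}=\rho_{i+1}^{(t)}\rho_i^{(t)}\rho_{i+1}^{(t)}$ for $1\le t\le k-1$, and $\sigma_i\sigma_{i+1}\sigma_i=\sigma_{i+1}\sigma_i\sigma_{i+1}$. An automorphism $\alpha$ of $UV_n(k)$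 descends along $q$ if there is an automorphism $\bar\alpha$ of $M_kVB_n$ with $\bar\alpha\circ q=q\circ\alpha$. Involutive means that the square is the identity. "Generate a subgroup of $\operatorname{Out}$" refers to the classes in $\operatorname{Out}(G)=\operatorname{Aut}(G)/\operatorname{Inn}(G)$. *)

theory Defs
  imports "HOL-Algebra.Bij" "HOL-Algebra.Elementary_Groups"
begin

section \<open>Groups given by generators and relations\<close>

text \<open>
  A letter \<open>(x, True)\<close> stands for the generator \<open>x\<close> and \<open>(x, False)\<close> for its formal inverse.
  A relation \<open>u = v\<close> is a pair of words. The presented group is the monoid of words over
  \<open>X \<times> UNIV\<close> modulo the least congruence containing the free cancellations and \<open>R\<close>,
  which is the quotient of the free group on \<open>X\<close> by the normal closure of the relators.
\<close>

type_synonym 'a word = "('a \<times> bool) list"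

definition words :: "'a set \<Rightarrow> 'a word set" where
  "words X = lists (X \<times> UNIV)"

inductive_set word_cong :: "'a set \<Rightarrow> ('a word \<times> 'a word) set \<Rightarrow> ('a word \<times> 'a word) set"
  for X R where
  refl: "w \<in> words X \<Longrightarrow> (w, w) \<in> word_cong X R"
| sym: "(u, v) \<in> word_cong X R \<Longrightarrow> (v, u) \<in> word_cong X R"
| trans: "(u, v) \<in> word_cong X R \<Longrightarrow> (v, w) \<in> word_cong X R \<Longrightarrow> (u, w) \<in> word_cong X R"
| append: "(u, v) \<in> word_cong X R \<Longrightarrow> (u', v') \<in> word_cong X R \<Longrightarrow> (u @ u', v @ v') \<in> word_cong X R"
| cancel: "x \<in> X \<Longrightarrow> ([(x, b), (x, \<not> b)], []) \<in> word_cong X R"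
| rel: "(u, v) \<in> R \<Longrightarrow> u \<in> words X \<Longrightarrow> v \<in> words X \<Longrightarrow> (u, v) \<in> word_cong X R"

definition presented_group :: "'a set \<Rightarrow> ('a word \<times> 'a word) set \<Rightarrow> 'a word set monoid" where
  "presented_group X R =
     \<lparr>carrier = words X // word_cong X R,
      monoid.mult = (\<lambda>A B. {w. \<exists>u\<in>A. \<exists>v\<in>B. (u @ v, w) \<in> word_cong X R}),
      one = word_cong X R `` {[]}\<rparr>"

definition word_class :: "'a set \<Rightarrow> ('a word \<times> 'a word) set \<Rightarrow> 'a word \<Rightarrow> 'a word set" where
  "word_class X R w = word_cong X R `` {w}"

definition pos :: "'a list \<Rightarrow> 'a word" where
  "pos xs = map (\<lambda>x. (x, True)) xs"


section \<open>The universal virtual braid group\<close>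

datatype uv_gen = Rho nat | Sigma nat nat

definition uv_gens :: "nat \<Rightarrow> nat \<Rightarrow> uv_gen set" where
  "uv_gens n k = {Rho i | i. i \<in> {1..<n}} \<union> {Sigma i t | i t. i \<in> {1..<n} \<and> t \<in> {1..k}}"

definition far :: "nat \<Rightarrow> nat \<Rightarrow> bool" where
  "far i j \<longleftrightarrow> \<bar>int i - int j\<bar> \<ge> 2"

definition uv_rels :: "nat \<Rightarrow> nat \<Rightarrow> (uv_gen word \<times> uv_gen word) set" where
  "uv_rels n k =
     {(pos [Rho i, Rho i], []) | i. i \<in> {1..<n}}
   \<union> {(pos [Rho i, Rho (i+1), Rho i], pos [Rho (i+1), Rho i, Rho (i+1)]) | i.
        i \<in> {1..<n} \<and> i + 1 < n}
   \<union> {(pos [Rho i, Rho j], pos [Rho j, Rho i]) | i j.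
        i \<in> {1..<n} \<and> j \<in> {1..<n} \<and> far i j}
   \<union> {(pos [Sigma i t, Sigma j l], pos [Sigma j l, Sigma i t]) | i j t l.
        i \<in> {1..<n} \<and> j \<in> {1..<n} \<and> far i j \<and> t \<in> {1..k} \<and> l \<in> {1..k}}
   \<union> {(pos [Sigma i t, Rho j], pos [Rho j, Sigma i t]) | i j t.
        i \<in> {1..<n} \<and> j \<in> {1..<n} \<and> far i j \<and> t \<in> {1..k}}
   \<union> {(pos [Rho i, Rho (i+1), Sigma i t], pos [Sigma (i+1) t, Rho i, Rho (i+1)]) | i t.
        i \<in> {1..<n} \<and> i + 1 < n \<and> t \<in> {1..k}}"

definition UV :: "nat \<Rightarrow> nat \<Rightarrow> uv_gen word set monoid" where
  "UV n k = presented_group (uv_gens n k) (uv_rels n k)"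

definition uv_rho :: "nat \<Rightarrow> nat \<Rightarrow> nat \<Rightarrow> uv_gen word set" where
  "uv_rho n k i = word_class (uv_gens n k) (uv_rels n k) (pos [Rho i])"

definition uv_sigma :: "nat \<Rightarrow> nat \<Rightarrow> nat \<Rightarrow> nat \<Rightarrow> uv_gen word set" where
  "uv_sigma n k i t = word_class (uv_gens n k) (uv_rels n k) (pos [Sigma i t])"


section \<open>The multi-virtual braid group and the quotient map\<close>

text \<open>\<open>MRho i \<beta>\<close> is the generator \<open>\<rho>\<^sub>i\<close> with superscript \<open>(\<beta>)\<close>.\<close>

datatype mv_gen = MSigma nat | MRho nat nat

definition mv_gens :: "nat \<Rightarrow> nat \<Rightarrow> mv_gen set" where
  "mv_gens n k = {MSigma i | i. i \<in> {1..<n}} \<union> {MRho i \<beta> | i \<beta>. i \<in> {1..<n} \<and> \<beta> < k}"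

fun q_gen :: "nat \<Rightarrow> uv_gen \<Rightarrow> mv_gen" where
  "q_gen k (Rho i) = MRho i 0"
| "q_gen k (Sigma i t) = (if t = k then MSigma i else MRho i t)"

definition q_word :: "nat \<Rightarrow> uv_gen word \<Rightarrow> mv_gen word" where
  "q_word k w = map (\<lambda>(x, b). (q_gen k x, b)) w"

definition mv_rels :: "nat \<Rightarrow> nat \<Rightarrow> (mv_gen word \<times> mv_gen word) set" where
  "mv_rels n k =
     {(q_word k u, q_word k v) | u v. (u, v) \<in> uv_rels n k}
   \<union> {(pos [MRho i t, MRho i t], []) | i t. i \<in> {1..<n} \<and> t \<in> {1..<k}}
   \<union> {(pos [MRho i t, MRho (i+1) t, MRho i t], pos [MRho (i+1) t, MRho i t, MRho (i+1) t]) | i t.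
        i \<in> {1..<n} \<and> i + 1 < n \<and> t \<in> {1..<k}}
   \<union> {(pos [MSigma i, MSigma (i+1), MSigma i], pos [MSigma (i+1), MSigma i, MSigma (i+1)]) | i.
        i \<in> {1..<n} \<and> i + 1 < n}"

definition MVB :: "nat \<Rightarrow> nat \<Rightarrow> mv_gen word set monoid" where
  "MVB n k = presented_group (mv_gens n k) (mv_rels n k)"

definition q_map :: "nat \<Rightarrow> nat \<Rightarrow> uv_gen word set \<Rightarrow> mv_gen word set" where
  "q_map n k A = (\<Union>w\<in>A. word_class (mv_gens n k) (mv_rels n k) (q_word k w))"


section \<open>Descending automorphisms and outer automorphisms\<close>

definition descends_to ::
  "('a, 'c) monoid_scheme \<Rightarrow> ('b, 'd) monoid_scheme \<Rightarrow> ('a \<Rightarrow> 'b) \<Rightarrow> ('a \<Rightarrow> 'a) \<Rightarrow> ('b \<Rightarrow> 'b) \<Rightarrow> bool"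
  where "descends_to G H q \<alpha> \<alpha>' \<longleftrightarrow>
    \<alpha> \<in> auto G \<and> \<alpha>' \<in> auto H \<and> (\<forall>x\<in>carrier G. \<alpha>' (q x) = q (\<alpha> x))"

definition involutive_on :: "'a set \<Rightarrow> ('a \<Rightarrow> 'a) \<Rightarrow> bool" where
  "involutive_on S f \<longleftrightarrow> (\<forall>x\<in>S. f (f x) = x)"

definition commute_on :: "'a set \<Rightarrow> ('a \<Rightarrow> 'a) \<Rightarrow> ('a \<Rightarrow> 'a) \<Rightarrow> bool" where
  "commute_on S f g \<longleftrightarrow> (\<forall>x\<in>S. f (g x) = g (f x))"

definition inner_auto :: "('a, 'c) monoid_scheme \<Rightarrow> 'a \<Rightarrow> 'a \<Rightarrow> 'a" where
  "inner_auto G g = (\<lambda>x\<in>carrier G. g \<otimes>\<^bsub>G\<^esub> x \<otimes>\<^bsub>G\<^esub> inv\<^bsub>G\<^esub> g)"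

definition Inn :: "('a, 'c) monoid_scheme \<Rightarrow> ('a \<Rightarrow> 'a) set" where
  "Inn G = inner_auto G ` carrier G"

definition Out :: "('a, 'c) monoid_scheme \<Rightarrow> ('a \<Rightarrow> 'a) set monoid" where
  "Out G = AutoGroup G Mod Inn G"

definition out_class :: "('a, 'c) monoid_scheme \<Rightarrow> ('a \<Rightarrow> 'a) \<Rightarrow> ('a \<Rightarrow> 'a) set" where
  "out_class G \<alpha> = Inn G #>\<^bsub>AutoGroup G\<^esub> \<alpha>"


section \<open>The automorphisms \<open>\<theta>\<close> and \<open>\<zeta>\<^sub>l\<close> of the universal virtual braid group\<close>

text \<open>
  Since elements of \<open>auto\<close> are extensional, each of the following predicates determines its
  automorphism uniquely; existence is \<open>ex1_theta\<close> and \<open>ex1_zeta\<close> below.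
\<close>

definition is_theta :: "nat \<Rightarrow> nat \<Rightarrow> (uv_gen word set \<Rightarrow> uv_gen word set) \<Rightarrow> bool" where
  "is_theta n k \<theta> \<longleftrightarrow> \<theta> \<in> auto (UV n k)
     \<and> (\<forall>i\<in>{1..<n}. \<theta> (uv_rho n k i) = uv_rho n k i)
     \<and> (\<forall>i\<in>{1..<n}. \<forall>t\<in>{1..k}. \<theta> (uv_sigma n k i t) = inv\<^bsub>UV n k\<^esub> uv_sigma n k i t)"

definition is_zeta :: "nat \<Rightarrow> nat \<Rightarrow> nat \<Rightarrow> (uv_gen word set \<Rightarrow> uv_gen word set) \<Rightarrow> bool" where
  "is_zeta n k l \<zeta> \<longleftrightarrow> \<zeta> \<in> auto (UV n k)
     \<and> (\<forall>i\<in>{1..<n}. \<zeta> (uv_rho n k i) = uv_rho n k i)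
     \<and> (\<forall>i\<in>{1..<n}. \<zeta> (uv_sigma n k i l) =
           uv_rho n k i \<otimes>\<^bsub>UV n k\<^esub> uv_sigma n k i l \<otimes>\<^bsub>UV n k\<^esub> uv_rho n k i)
     \<and> (\<forall>i\<in>{1..<n}. \<forall>t\<in>{1..k}. t \<noteq> l \<longrightarrow> \<zeta> (uv_sigma n k i t) = uv_sigma n k i t)"


section \<open>Basic facts\<close>

lemma words_simps [simp]:
  "[] \<in> words X" "(p # w) \<in> words X \<longleftrightarrow> fst p \<in> X \<and> w \<in> words X"
  "u @ v \<in> words X \<longleftrightarrow> u \<in> words X \<and> v \<in> words X"
  by (auto simp: words_def mem_Times_iff)

lemma word_cong_words: "(u, v) \<in> word_cong X R \<Longrightarrow> u \<in> words X \<and> v \<in> words X"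
  by (induction rule: word_cong.induct) auto

lemma equiv_word_cong: "equiv (words X) (word_cong X R)"
  by (intro equivI refl_onI symI transI)
    (auto dest: word_cong_words word_cong.sym intro: word_cong.refl word_cong.trans)

lemma word_class_eq_iff:
  "u \<in> words X \<Longrightarrow> v \<in> words X \<Longrightarrow>
    word_class X R u = word_class X R v \<longleftrightarrow> (u, v) \<in> word_cong X R"
  unfolding word_class_def using eq_equiv_class_iff[OF equiv_word_cong] by metis

lemma word_class_mult:
  assumes "u \<in> words X" "v \<in> words X"
  shows "word_class X R u \<otimes>\<^bsub>presented_group X R\<^esub> word_class X R v = word_class X R (u @ v)"
  unfolding presented_group_def word_class_def using assms
  by (auto intro: word_cong.refl dest: word_cong.append word_cong.sym intro: word_cong.trans)

lemma word_class_one: "\<one>\<^bsub>presented_group X R\<^esub> = word_class X R []"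
  by (simp add: presented_group_def word_class_def)

lemma carrier_presented_group: "carrier (presented_group X R) = word_class X R ` words X"
  by (auto simp: presented_group_def word_class_def quotient_def)

fun word_inv :: "'a word \<Rightarrow> 'a word" where
  "word_inv [] = []"
| "word_inv ((x, b) # w) = word_inv w @ [(x, \<not> b)]"

lemma word_inv_words: "w \<in> words X \<Longrightarrow> word_inv w \<in> words X"
  by (induction w rule: word_inv.induct) auto

lemma word_inv_cancel: "w \<in> words X \<Longrightarrow> (word_inv w @ w, []) \<in> word_cong X R"
proof (induction w rule: word_inv.induct)
  case 1
  show ?case by (simp add: word_cong.refl)
next
  case (2 x b w)
  then have x: "x \<in> X" and w: "w \<in> words X" by auto
  have "([(x, \<not> b), (x, b)], []) \<in> word_cong X R"
    using word_cong.cancel[OF x, of "\<not> b"] by simp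
  then have "([(x, \<not> b), (x, b)] @ w, [] @ w) \<in> word_cong X R"
    using w by (intro word_cong.append word_cong.refl)
  from word_cong.append[OF word_cong.refl this] w
  have "(word_inv w @ ([(x, \<not> b), (x, b)] @ w), word_inv w @ ([] @ w)) \<in> word_cong X R"
    by (simp add: word_inv_words)
  then show ?case using 2 word_cong.trans by fastforce
qed

lemma group_presented_group: "group (presented_group X R)"
proof (rule groupI)
  fix x assume "x \<in> carrier (presented_group X R)"
  then obtain w where w: "w \<in> words X" "x = word_class X R w"
    by (auto simp: carrier_presented_group)
  then have "word_class X R (word_inv w) \<otimes>\<^bsub>presented_group X R\<^esub> x = \<one>\<^bsub>presented_group X R\<^esub>"
    by (simp add: word_class_mult word_class_one word_inv_words word_class_eq_iff word_inv_cancel)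
  then show "\<exists>y\<in>carrier (presented_group X R). y \<otimes>\<^bsub>presented_group X R\<^esub> x = \<one>\<^bsub>presented_group X R\<^esub>"
    using w word_inv_words by (auto simp: carrier_presented_group)
qed (auto simp: carrier_presented_group word_class_mult word_class_one)

fun word_eval :: "('b, 'c) monoid_scheme \<Rightarrow> ('a \<Rightarrow> 'b) \<Rightarrow> 'a word \<Rightarrow> 'b" where
  "word_eval G f [] = \<one>\<^bsub>G\<^esub>"
| "word_eval G f ((x, b) # w) = (if b then f x else inv\<^bsub>G\<^esub> (f x)) \<otimes>\<^bsub>G\<^esub> word_eval G f w"

context group
begin

lemma word_eval_closed: "f ` X \<subseteq> carrier G \<Longrightarrow> w \<in> words X \<Longrightarrow> word_eval G f w \<in> carrier G"
  by (induction w) auto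

lemma word_eval_append:
  assumes "f ` X \<subseteq> carrier G" "u \<in> words X" "v \<in> words X"
  shows "word_eval G f (u @ v) = word_eval G f u \<otimes> word_eval G f v"
  using assms
proof (induction u)
  case (Cons p u)
  then have "f (fst p) \<in> carrier G" by auto
  with Cons show ?case using word_eval_closed[of f X] by (cases p) (auto simp: m_assoc)
qed (auto simp: word_eval_closed)

lemma word_eval_cong:
  assumes "f ` X \<subseteq> carrier G"
    and "\<And>u v. (u, v) \<in> R \<Longrightarrow> u \<in> words X \<Longrightarrow> v \<in> words X \<Longrightarrow> word_eval G f u = word_eval G f v"
    and "(u, v) \<in> word_cong X R"
  shows "word_eval G f u = word_eval G f v"
  using assms(3)
proof (induction rule: word_cong.induct)
  case (append u v u' v')
  then show ?case using word_eval_append[OF assms(1)] word_cong_words by metis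
next
  case (cancel x b)
  then have "f x \<in> carrier G" using assms(1) by auto
  then show ?case by (cases b) auto
qed (auto intro: assms(2))

end

lemma presented_group_hom:
  assumes G: "group G" and f: "f ` X \<subseteq> carrier G"
    and R: "\<And>u v. (u, v) \<in> R \<Longrightarrow> u \<in> words X \<Longrightarrow> v \<in> words X \<Longrightarrow> word_eval G f u = word_eval G f v"
  shows "\<exists>h\<in>hom (presented_group X R) G. \<forall>w\<in>words X. h (word_class X R w) = word_eval G f w"
proof -
  interpret group G by (rule G)
  define h where "h A = word_eval G f (SOME w. w \<in> A)" for A
  have h: "h (word_class X R w) = word_eval G f w" if "w \<in> words X" for w
  proof -
    have "w \<in> word_class X R w" using that by (auto simp: word_class_def intro: word_cong.refl)
    then have "(SOME u. u \<in> word_class X R w) \<in> word_class X R w" by (rule someI)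
    then show ?thesis
      using word_eval_cong[OF f R] unfolding h_def by (auto simp: word_class_def)
  qed
  then have "h \<in> hom (presented_group X R) G"
    by (intro homI) (auto simp: carrier_presented_group word_class_mult h word_eval_closed[OF f]
        word_eval_append[OF f])
  with h show ?thesis by blast
qed

lemma word_class_inv:
  assumes "x \<in> X"
  shows "inv\<^bsub>presented_group X R\<^esub> (word_class X R [(x, True)]) = word_class X R [(x, False)]"
proof -
  interpret group "presented_group X R" by (rule group_presented_group)
  have "([(x, False), (x, \<not> False)], []) \<in> word_cong X R" by (rule word_cong.cancel[OF assms])
  then show ?thesis using assms
    by (intro inv_equality)
      (auto simp: word_class_mult word_class_one word_class_eq_iff carrier_presented_group)
qed

lemma hom_eq_word_eval:
  assumes G: "group G" and h: "h \<in> hom (presented_group X R) G" and w: "w \<in> words X"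
  shows "h (word_class X R w) = word_eval G (\<lambda>x. h (word_class X R [(x, True)])) w"
proof -
  interpret group_hom "presented_group X R" G h
    using G h group_presented_group by (auto simp: group_hom_def group_hom_axioms_def)
  show ?thesis using w
  proof (induction w)
    case Nil
    show ?case using hom_one by (simp add: word_class_one)
  next
    case (Cons p w)
    then have p: "fst p \<in> X" and w: "w \<in> words X" by auto
    have "word_class X R (p # w) = word_class X R [p] \<otimes>\<^bsub>presented_group X R\<^esub> word_class X R w"
      using p w by (simp add: word_class_mult)
    moreover have "word_class X R [p] \<in> carrier (presented_group X R)"
        "word_class X R w \<in> carrier (presented_group X R)"
        "word_class X R [(fst p, True)] \<in> carrier (presented_group X R)"
      using p w by (auto simp: carrier_presented_group)
    ultimately show ?case using Cons p w
      by (cases p) (auto simp flip: word_class_inv)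
  qed
qed

lemma word_eval_fun_cong:
  "(\<And>x. x \<in> X \<Longrightarrow> f x = g x) \<Longrightarrow> w \<in> words X \<Longrightarrow> word_eval G f w = word_eval G g w"
  by (induction w) auto

lemma hom_presented_group_eqI:
  assumes "group G" "h \<in> hom (presented_group X R) G" "h' \<in> hom (presented_group X R) G"
    and "\<And>x. x \<in> X \<Longrightarrow> h (word_class X R [(x, True)]) = h' (word_class X R [(x, True)])"
    and "a \<in> carrier (presented_group X R)"
  shows "h a = h' a"
proof -
  obtain w where w: "w \<in> words X" "a = word_class X R w"
    using assms(5) by (auto simp: carrier_presented_group)
  show ?thesis
    unfolding w(2) hom_eq_word_eval[OF assms(1,2) w(1)] hom_eq_word_eval[OF assms(1,3) w(1)]
    using assms(4) w(1) by (rule word_eval_fun_cong)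
qed

lemma hom_involution_auto:
  assumes "group G" "h \<in> hom G G" "\<And>x. x \<in> carrier G \<Longrightarrow> h (h x) = x"
  shows "restrict h (carrier G) \<in> auto G"
proof -
  have c: "\<And>x. x \<in> carrier G \<Longrightarrow> h x \<in> carrier G" using assms(2) by (auto simp: hom_def)
  have "bij_betw (restrict h (carrier G)) (carrier G) (carrier G)"
    by (rule bij_betw_byWitness[where f' = h]) (auto simp: c assms(3))
  moreover have "restrict h (carrier G) \<in> hom G G"
    using assms(2) group.is_monoid[OF assms(1)] by (auto simp: hom_def monoid.m_closed)
  ultimately show ?thesis by (auto simp: auto_def Bij_def)
qed

lemma group_UV: "group (UV n k)"
  unfolding UV_def by (rule group_presented_group)

lemma group_MVB: "group (MVB n k)"
  unfolding MVB_def by (rule group_presented_group)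

context
  fixes n k :: nat
begin

interpretation U: group "UV n k" by (rule group_UV)

lemma Rho_gens [simp]: "Rho i \<in> uv_gens n k \<longleftrightarrow> i \<in> {1..<n}"
  and Sigma_gens [simp]: "Sigma i t \<in> uv_gens n k \<longleftrightarrow> i \<in> {1..<n} \<and> t \<in> {1..k}"
  by (auto simp: uv_gens_def)

lemma uv_rho_closed [simp, intro]: "i \<in> {1..<n} \<Longrightarrow> uv_rho n k i \<in> carrier (UV n k)"
  and uv_sigma_closed [simp, intro]:
    "i \<in> {1..<n} \<Longrightarrow> t \<in> {1..k} \<Longrightarrow> uv_sigma n k i t \<in> carrier (UV n k)"
  by (auto simp: UV_def carrier_presented_group uv_rho_def uv_sigma_def pos_def)

lemma UV_eval:
  assumes "w \<in> words (uv_gens n k)"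
  shows "word_class (uv_gens n k) (uv_rels n k) w =
    word_eval (UV n k) (\<lambda>x. word_class (uv_gens n k) (uv_rels n k) (pos [x])) w"
proof -
  have "(\<lambda>x. x) \<in> hom (UV n k) (UV n k)" by (auto simp: hom_def)
  then have "(\<lambda>x. x) \<in> hom (presented_group (uv_gens n k) (uv_rels n k)) (UV n k)"
    by (simp add: UV_def)
  from hom_eq_word_eval[OF group_UV this assms] show ?thesis
    by (simp add: pos_def)
qed

lemma UV_rel:
  assumes "(u, v) \<in> uv_rels n k" "u \<in> words (uv_gens n k)" "v \<in> words (uv_gens n k)"
  shows "word_eval (UV n k) (\<lambda>x. word_class (uv_gens n k) (uv_rels n k) (pos [x])) u =
    word_eval (UV n k) (\<lambda>x. word_class (uv_gens n k) (uv_rels n k) (pos [x])) v"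
  using UV_eval assms word_class_eq_iff word_cong.rel by metis

lemma rho_rho:
  assumes "i \<in> {1..<n}" shows "uv_rho n k i \<otimes>\<^bsub>UV n k\<^esub> uv_rho n k i = \<one>\<^bsub>UV n k\<^esub>"
  using UV_rel[of "pos [Rho i, Rho i]" "[]"] assms
  by (simp add: pos_def uv_rels_def flip: uv_rho_def[unfolded pos_def, simplified])

lemma rho_braid:
  assumes "i \<in> {1..<n}" "i + 1 < n"
  shows "uv_rho n k i \<otimes>\<^bsub>UV n k\<^esub> (uv_rho n k (i+1) \<otimes>\<^bsub>UV n k\<^esub> uv_rho n k i)
    = uv_rho n k (i+1) \<otimes>\<^bsub>UV n k\<^esub> (uv_rho n k i \<otimes>\<^bsub>UV n k\<^esub> uv_rho n k (i+1))"
  using UV_rel[of "pos [Rho i, Rho (i+1), Rho i]" "pos [Rho (i+1), Rho i, Rho (i+1)]"] assms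
  by (simp add: pos_def uv_rels_def flip: uv_rho_def[unfolded pos_def, simplified])

lemma rho_far:
  assumes "i \<in> {1..<n}" "j \<in> {1..<n}" "far i j"
  shows "uv_rho n k i \<otimes>\<^bsub>UV n k\<^esub> uv_rho n k j = uv_rho n k j \<otimes>\<^bsub>UV n k\<^esub> uv_rho n k i"
  using UV_rel[of "pos [Rho i, Rho j]" "pos [Rho j, Rho i]"] assms
  by (simp add: pos_def uv_rels_def flip: uv_rho_def[unfolded pos_def, simplified])

lemma sigma_far:
  assumes "i \<in> {1..<n}" "j \<in> {1..<n}" "far i j" "t \<in> {1..k}" "l \<in> {1..k}"
  shows "uv_sigma n k i t \<otimes>\<^bsub>UV n k\<^esub> uv_sigma n k j l
    = uv_sigma n k j l \<otimes>\<^bsub>UV n k\<^esub> uv_sigma n k i t"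
  using UV_rel[of "pos [Sigma i t, Sigma j l]" "pos [Sigma j l, Sigma i t]"] assms
  by (simp add: pos_def uv_rels_def flip: uv_sigma_def[unfolded pos_def, simplified])

lemma sigma_rho_far:
  assumes "i \<in> {1..<n}" "j \<in> {1..<n}" "far i j" "t \<in> {1..k}"
  shows "uv_sigma n k i t \<otimes>\<^bsub>UV n k\<^esub> uv_rho n k j = uv_rho n k j \<otimes>\<^bsub>UV n k\<^esub> uv_sigma n k i t"
  using UV_rel[of "pos [Sigma i t, Rho j]" "pos [Rho j, Sigma i t]"] assms
  by (simp add: pos_def uv_rels_def
      flip: uv_sigma_def[unfolded pos_def, simplified] uv_rho_def[unfolded pos_def, simplified])

lemma rho_rho_sigma:
  assumes "i \<in> {1..<n}" "i + 1 < n" "t \<in> {1..k}"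
  shows "uv_rho n k i \<otimes>\<^bsub>UV n k\<^esub> (uv_rho n k (i+1) \<otimes>\<^bsub>UV n k\<^esub> uv_sigma n k i t)
    = uv_sigma n k (i+1) t \<otimes>\<^bsub>UV n k\<^esub> (uv_rho n k i \<otimes>\<^bsub>UV n k\<^esub> uv_rho n k (i+1))"
  using UV_rel[of "pos [Rho i, Rho (i+1), Sigma i t]" "pos [Sigma (i+1) t, Rho i, Rho (i+1)]"] assms
  by (simp add: pos_def uv_rels_def
      flip: uv_sigma_def[unfolded pos_def, simplified] uv_rho_def[unfolded pos_def, simplified])

lemma UV_endo:
  assumes s: "\<And>i t. i \<in> {1..<n} \<Longrightarrow> t \<in> {1..k} \<Longrightarrow> s i t \<in> carrier (UV n k)"
    and ss: "\<And>i j t l. i \<in> {1..<n} \<Longrightarrow> j \<in> {1..<n} \<Longrightarrow> far i j \<Longrightarrow> t \<in> {1..k} \<Longrightarrow> l \<in> {1..k} \<Longrightarrow>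
      s i t \<otimes>\<^bsub>UV n k\<^esub> s j l = s j l \<otimes>\<^bsub>UV n k\<^esub> s i t"
    and sr: "\<And>i j t. i \<in> {1..<n} \<Longrightarrow> j \<in> {1..<n} \<Longrightarrow> far i j \<Longrightarrow> t \<in> {1..k} \<Longrightarrow>
      s i t \<otimes>\<^bsub>UV n k\<^esub> uv_rho n k j = uv_rho n k j \<otimes>\<^bsub>UV n k\<^esub> s i t"
    and rrs: "\<And>i t. i \<in> {1..<n} \<Longrightarrow> i + 1 < n \<Longrightarrow> t \<in> {1..k} \<Longrightarrow>
      uv_rho n k i \<otimes>\<^bsub>UV n k\<^esub> (uv_rho n k (i+1) \<otimes>\<^bsub>UV n k\<^esub> s i t)
      = s (i+1) t \<otimes>\<^bsub>UV n k\<^esub> (uv_rho n k i \<otimes>\<^bsub>UV n k\<^esub> uv_rho n k (i+1))"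
  shows "\<exists>h\<in>hom (UV n k) (UV n k). (\<forall>i\<in>{1..<n}. h (uv_rho n k i) = uv_rho n k i)
    \<and> (\<forall>i\<in>{1..<n}. \<forall>t\<in>{1..k}. h (uv_sigma n k i t) = s i t)"
proof -
  define f where "f = case_uv_gen (uv_rho n k) s"
  have f: "f ` uv_gens n k \<subseteq> carrier (UV n k)"
    using s by (auto simp: f_def uv_gens_def)
  have "word_eval (UV n k) f u = word_eval (UV n k) f v" if "(u, v) \<in> uv_rels n k" for u v
    using that unfolding uv_rels_def
    by (elim UnE CollectE exE conjE Pair_inject; simp add: f_def pos_def s rho_rho
        rho_braid[simplified] sr rrs[simplified]; intro rho_far ss; simp)
  from presented_group_hom[OF group_UV f, of "uv_rels n k", OF this]
  obtain h where h: "h \<in> hom (UV n k) (UV n k)"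
    "\<forall>w\<in>words (uv_gens n k). h (word_class (uv_gens n k) (uv_rels n k) w) = word_eval (UV n k) f w"
    by (auto simp: UV_def)
  then show ?thesis
    using s uv_rho_closed
    by (intro bexI[of _ h]) (simp_all add: f_def pos_def uv_sigma_def uv_rho_def)
qed

lemma UV_hom_eqI:
  assumes "h \<in> hom (UV n k) (UV n k)" "h' \<in> hom (UV n k) (UV n k)"
    and "\<And>i. i \<in> {1..<n} \<Longrightarrow> h (uv_rho n k i) = h' (uv_rho n k i)"
    and "\<And>i t. i \<in> {1..<n} \<Longrightarrow> t \<in> {1..k} \<Longrightarrow> h (uv_sigma n k i t) = h' (uv_sigma n k i t)"
    and "a \<in> carrier (UV n k)"
  shows "h a = h' a"
proof (rule hom_presented_group_eqI[of "UV n k" h "uv_gens n k" "uv_rels n k"])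
  show "a \<in> carrier (presented_group (uv_gens n k) (uv_rels n k))"
    using assms(5) by (simp add: UV_def)
  fix x assume "x \<in> uv_gens n k"
  then show "h (word_class (uv_gens n k) (uv_rels n k) [(x, True)]) =
      h' (word_class (uv_gens n k) (uv_rels n k) [(x, True)])"
    using assms(3,4) by (auto simp: uv_gens_def uv_rho_def uv_sigma_def pos_def)
qed (use assms group_UV in \<open>auto simp: UV_def\<close>)

lemma UV_auto_unique:
  assumes "\<alpha> \<in> auto (UV n k)" "\<beta> \<in> auto (UV n k)"
    and "\<And>i. i \<in> {1..<n} \<Longrightarrow> \<alpha> (uv_rho n k i) = \<beta> (uv_rho n k i)"
    and "\<And>i t. i \<in> {1..<n} \<Longrightarrow> t \<in> {1..k} \<Longrightarrow> \<alpha> (uv_sigma n k i t) = \<beta> (uv_sigma n k i t)"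
  shows "\<alpha> = \<beta>"
proof (rule extensionalityI[of _ "carrier (UV n k)"])
  show "\<alpha> \<in> extensional (carrier (UV n k))" "\<beta> \<in> extensional (carrier (UV n k))"
    using assms(1,2) by (auto simp: auto_def Bij_def)
qed (rule UV_hom_eqI, use assms in \<open>auto simp: auto_def\<close>)

lemma UV_involution:
  assumes h: "h \<in> hom (UV n k) (UV n k)"
    and r: "\<And>i. i \<in> {1..<n} \<Longrightarrow> h (uv_rho n k i) = uv_rho n k i"
    and s: "\<And>i t. i \<in> {1..<n} \<Longrightarrow> t \<in> {1..k} \<Longrightarrow> h (h (uv_sigma n k i t)) = uv_sigma n k i t"
  shows "restrict h (carrier (UV n k)) \<in> auto (UV n k)"
proof (rule hom_involution_auto[OF group_UV h])
  fix x assume x: "x \<in> carrier (UV n k)"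
  have "(h \<circ> h) x = (\<lambda>x. x) x"
  proof (rule UV_hom_eqI[OF _ _ _ _ x])
    show "h \<circ> h \<in> hom (UV n k) (UV n k)" using h by (auto simp: hom_def Pi_iff)
    show "(\<lambda>x. x) \<in> hom (UV n k) (UV n k)" by (auto simp: hom_def)
  qed (simp_all add: r s)
  then show "h (h x) = x" by simp
qed

theorem ex1_theta: "\<exists>!\<theta>. is_theta n k \<theta>"
proof -
  have comm_inv: "inv\<^bsub>UV n k\<^esub> x \<otimes>\<^bsub>UV n k\<^esub> y = y \<otimes>\<^bsub>UV n k\<^esub> inv\<^bsub>UV n k\<^esub> x"
    if "x \<otimes>\<^bsub>UV n k\<^esub> y = y \<otimes>\<^bsub>UV n k\<^esub> x" "x \<in> carrier (UV n k)" "y \<in> carrier (UV n k)" for x y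
    using that U.inv_comm U.inv_solve_left U.inv_solve_right U.m_assoc U.m_closed U.inv_closed by metis
  have conj_inv: "c \<otimes>\<^bsub>UV n k\<^esub> inv\<^bsub>UV n k\<^esub> x = inv\<^bsub>UV n k\<^esub> y \<otimes>\<^bsub>UV n k\<^esub> c"
    if "c \<otimes>\<^bsub>UV n k\<^esub> x = y \<otimes>\<^bsub>UV n k\<^esub> c" "c \<in> carrier (UV n k)" "x \<in> carrier (UV n k)" "y \<in> carrier (UV n k)"
    for c x y
    using that U.inv_solve_left U.inv_solve_right U.m_assoc U.m_closed U.inv_closed by metis
  have "\<exists>h\<in>hom (UV n k) (UV n k). (\<forall>i\<in>{1..<n}. h (uv_rho n k i) = uv_rho n k i)
    \<and> (\<forall>i\<in>{1..<n}. \<forall>t\<in>{1..k}. h (uv_sigma n k i t) = inv\<^bsub>UV n k\<^esub> (uv_sigma n k i t))"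
  proof (rule UV_endo)
    fix i t assume i: "i \<in> {1..<n}" "i + 1 < n" and t: "t \<in> {1..k}"
    then have i': "i + 1 \<in> {1..<n}" by simp
    show "uv_rho n k i \<otimes>\<^bsub>UV n k\<^esub> (uv_rho n k (i+1) \<otimes>\<^bsub>UV n k\<^esub> inv\<^bsub>UV n k\<^esub> uv_sigma n k i t)
      = inv\<^bsub>UV n k\<^esub> uv_sigma n k (i+1) t \<otimes>\<^bsub>UV n k\<^esub> (uv_rho n k i \<otimes>\<^bsub>UV n k\<^esub> uv_rho n k (i+1))"
      using conj_inv[of "uv_rho n k i \<otimes>\<^bsub>UV n k\<^esub> uv_rho n k (i+1)" "uv_sigma n k i t" "uv_sigma n k (i+1) t"]
        rho_rho_sigma[OF i t] i i' t by (simp add: U.m_assoc)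
  next
    fix i j t l assume "i \<in> {1..<n}" "j \<in> {1..<n}" "far i j" "t \<in> {1..k}" "l \<in> {1..k}"
    with sigma_far[OF this] show "inv\<^bsub>UV n k\<^esub> uv_sigma n k i t \<otimes>\<^bsub>UV n k\<^esub> inv\<^bsub>UV n k\<^esub> uv_sigma n k j l
      = inv\<^bsub>UV n k\<^esub> uv_sigma n k j l \<otimes>\<^bsub>UV n k\<^esub> inv\<^bsub>UV n k\<^esub> uv_sigma n k i t"
      by (intro comm_inv comm_inv[symmetric]) simp_all
  next
    fix i j t assume "i \<in> {1..<n}" "j \<in> {1..<n}" "far i j" "t \<in> {1..k}"
    with sigma_rho_far[OF this] show "inv\<^bsub>UV n k\<^esub> uv_sigma n k i t \<otimes>\<^bsub>UV n k\<^esub> uv_rho n k j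
      = uv_rho n k j \<otimes>\<^bsub>UV n k\<^esub> inv\<^bsub>UV n k\<^esub> uv_sigma n k i t"
      by (intro comm_inv) simp_all
  qed simp
  then obtain h where h: "h \<in> hom (UV n k) (UV n k)"
    "\<And>i. i \<in> {1..<n} \<Longrightarrow> h (uv_rho n k i) = uv_rho n k i"
    "\<And>i t. i \<in> {1..<n} \<Longrightarrow> t \<in> {1..k} \<Longrightarrow> h (uv_sigma n k i t) = inv\<^bsub>UV n k\<^esub> (uv_sigma n k i t)"
    by blast
  interpret H: group_hom "UV n k" "UV n k" h
    using h(1) by unfold_locales
  have "restrict h (carrier (UV n k)) \<in> auto (UV n k)"
    by (rule UV_involution[OF h(1,2)])
      (simp_all add: h(3) H.hom_inv)
  then have "is_theta n k (restrict h (carrier (UV n k)))"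
    using h by (simp add: is_theta_def)
  moreover have "\<alpha> = \<beta>" if "is_theta n k \<alpha>" "is_theta n k \<beta>" for \<alpha> \<beta>
    using that by (intro UV_auto_unique) (auto simp: is_theta_def)
  ultimately show ?thesis by blast
qed

theorem ex1_zeta:
  assumes l: "l \<in> {1..k}"
  shows "\<exists>!\<zeta>. is_zeta n k l \<zeta>"
proof -
  let ?r = "uv_rho n k" and ?s = "uv_sigma n k"
  let ?m = "monoid.mult (UV n k)"
  define z where "z i t = (if t = l then ?m (?m (?r i) (?s i t)) (?r i) else ?s i t)" for i t
  have zc: "z i t \<in> carrier (UV n k)" if "i \<in> {1..<n}" "t \<in> {1..k}" for i t
    using that by (simp add: z_def)
  have prod_comm: "?m (?m (?m a b) a) c = ?m c (?m (?m a b) a)"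
    if "?m a c = ?m c a" "?m b c = ?m c b"
      "a \<in> carrier (UV n k)" "b \<in> carrier (UV n k)" "c \<in> carrier (UV n k)" for a b c
    using that U.m_assoc U.m_closed by metis
  have zr: "?m (z i t) (?r j) = ?m (?r j) (z i t)"
    if "i \<in> {1..<n}" "j \<in> {1..<n}" "far i j" "t \<in> {1..k}" for i j t
    using that rho_far[OF that(1-3)] sigma_rho_far[OF that]
    by (cases "t = l") (simp_all add: z_def prod_comm)
  have far_sym: "far j i" if "far i j" for i j using that by (auto simp: far_def)
  have zs: "?m (z i t) (?s j m) = ?m (?s j m) (z i t)"
    if "i \<in> {1..<n}" "j \<in> {1..<n}" "far i j" "t \<in> {1..k}" "m \<in> {1..k}" for i j t m
    using that sigma_far[OF that] sigma_rho_far[OF that(2,1) far_sym[OF that(3)] that(5)]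
    by (cases "t = l") (simp_all add: z_def prod_comm)
  have zz: "?m (z i t) (z j m) = ?m (z j m) (z i t)"
    if "i \<in> {1..<n}" "j \<in> {1..<n}" "far i j" "t \<in> {1..k}" "m \<in> {1..k}" for i j t m
  proof (cases "m = l")
    case True
    have "?m (z j m) (z i t) = ?m (z i t) (z j m)"
      unfolding z_def[of j m] using True that zc zr zs by (simp add: prod_comm)
    then show ?thesis by simp
  next
    case False
    then show ?thesis using that zs by (simp add: z_def[of j])
  qed
  have rrz: "?m (?r i) (?m (?r (i+1)) (z i t)) = ?m (z (i+1) t) (?m (?r i) (?r (i+1)))"
    if i: "i \<in> {1..<n}" "i + 1 < n" and t: "t \<in> {1..k}" for i t
  proof (cases "t = l")
    case True
    let ?a = "?r i" and ?b = "?r (i+1)" and ?x = "?s i t" and ?y = "?s (i+1) t"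
    have i': "i + 1 \<in> {1..<n}" using i by simp
    note c = uv_rho_closed[OF i(1)] uv_rho_closed[OF i'] uv_sigma_closed[OF i(1) t] uv_sigma_closed[OF i' t]
    have "?m ?a (?m ?b (?m (?m ?a ?x) ?a)) = ?m (?m ?a (?m ?b ?a)) (?m ?x ?a)"
      using c by (simp add: U.m_assoc)
    also have "\<dots> = ?m ?b (?m (?m ?a (?m ?b ?x)) ?a)"
      unfolding rho_braid[OF i] using c by (simp add: U.m_assoc)
    also have "\<dots> = ?m ?b (?m ?y (?m ?a (?m ?b ?a)))"
      unfolding rho_rho_sigma[OF i t] using c by (simp add: U.m_assoc)
    also have "\<dots> = ?m (?m (?m ?b ?y) ?b) (?m ?a ?b)"
      unfolding rho_braid[OF i] using c by (simp add: U.m_assoc)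
    finally show ?thesis using True by (simp add: z_def)
  next
    case False
    then show ?thesis using rho_rho_sigma[OF i t] by (simp add: z_def)
  qed
  obtain h where h: "h \<in> hom (UV n k) (UV n k)"
    "\<And>i. i \<in> {1..<n} \<Longrightarrow> h (?r i) = ?r i"
    "\<And>i t. i \<in> {1..<n} \<Longrightarrow> t \<in> {1..k} \<Longrightarrow> h (?s i t) = z i t"
    using UV_endo[of z, OF zc zz zr rrz] by blast
  interpret H: group_hom "UV n k" "UV n k" h
    using h(1) by unfold_locales
  have "h (h (?s i t)) = ?s i t" if "i \<in> {1..<n}" "t \<in> {1..k}" for i t
  proof (cases "t = l")
    case True
    note c = uv_rho_closed[OF that(1)] uv_sigma_closed[OF that]
    have "h (h (?s i t)) = ?m (?m (?r i) (?m (?m (?r i) (?s i t)) (?r i))) (?r i)"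
      using True that c by (simp add: h z_def H.hom_mult)
    also have "\<dots> = ?m (?m (?m (?r i) (?r i)) (?s i t)) (?m (?r i) (?r i))"
      using c by (simp add: U.m_assoc)
    finally show ?thesis using rho_rho[OF that(1)] c by simp
  qed (use that in \<open>simp add: h z_def\<close>)
  then have "restrict h (carrier (UV n k)) \<in> auto (UV n k)"
    by (intro UV_involution[OF h(1,2)])
  then have "is_zeta n k l (restrict h (carrier (UV n k)))"
    using h l by (simp add: is_zeta_def z_def)
  moreover have "\<alpha> = \<beta>" if "is_zeta n k l \<alpha>" "is_zeta n k l \<beta>" for \<alpha> \<beta>
  proof (rule UV_auto_unique)
    fix i t assume "i \<in> {1..<n}" "t \<in> {1..k}"
    then show "\<alpha> (?s i t) = \<beta> (?s i t)"
      using that by (cases "t = l") (auto simp: is_zeta_def)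
  qed (use that in \<open>auto simp: is_zeta_def\<close>)
  ultimately show ?thesis by blast
qed

end

lemma word_class_hom:
  assumes "f ` X \<subseteq> Y"
    and "\<And>u v. (u, v) \<in> R \<Longrightarrow> (map (\<lambda>(x, b). (f x, b)) u, map (\<lambda>(x, b). (f x, b)) v) \<in> S"
    and "(u, v) \<in> word_cong X R"
  shows "(map (\<lambda>(x, b). (f x, b)) u, map (\<lambda>(x, b). (f x, b)) v) \<in> word_cong Y S"
proof -
  have w: "map (\<lambda>(x, b). (f x, b)) w \<in> words Y" if "w \<in> words X" for w
    using that assms(1) by (induction w) auto
  show ?thesis
    using assms(3)
  proof (induction rule: word_cong.induct)
    case (cancel x b)
    then show ?case using assms(1) word_cong.cancel[of "f x" Y b] by auto
  qed (auto intro: word_cong.intros w assms(2))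
qed

lemma q_gen_gens: "k \<ge> 1 \<Longrightarrow> q_gen k ` uv_gens n k \<subseteq> mv_gens n k"
  by (force simp: uv_gens_def mv_gens_def split: if_splits)

lemma q_word_cong:
  "k \<ge> 1 \<Longrightarrow> (u, v) \<in> word_cong (uv_gens n k) (uv_rels n k) \<Longrightarrow>
    (q_word k u, q_word k v) \<in> word_cong (mv_gens n k) (mv_rels n k)"
  unfolding q_word_def
  by (rule word_class_hom[OF q_gen_gens]) (auto simp: mv_rels_def q_word_def)

lemma q_map_word_class:
  assumes k: "k \<ge> 1" and "w \<in> words (uv_gens n k)"
  shows "q_map n k (word_class (uv_gens n k) (uv_rels n k) w)
    = word_class (mv_gens n k) (mv_rels n k) (q_word k w)"
proof -
  have "word_class (mv_gens n k) (mv_rels n k) (q_word k u)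
      = word_class (mv_gens n k) (mv_rels n k) (q_word k w)"
    if "u \<in> word_class (uv_gens n k) (uv_rels n k) w" for u
  proof -
    have "(q_word k w, q_word k u) \<in> word_cong (mv_gens n k) (mv_rels n k)"
      using that k by (intro q_word_cong) (simp_all add: word_class_def)
    then show ?thesis using word_class_eq_iff word_cong_words by metis
  qed
  moreover have "w \<in> word_class (uv_gens n k) (uv_rels n k) w"
    using assms(2) by (simp add: word_class_def word_cong.refl)
  ultimately show ?thesis unfolding q_map_def by blast
qed

lemma q_word_surj:
  assumes "k \<ge> 1" "w \<in> words (mv_gens n k)"
  shows "\<exists>u\<in>words (uv_gens n k). q_word k u = w"
  using assms(2)
proof (induction w)
  case (Cons p w)
  then obtain u where u: "u \<in> words (uv_gens n k)" "q_word k u = w" by auto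
  obtain x where x: "x \<in> uv_gens n k" "q_gen k x = fst p"
  proof (cases "fst p")
    case (MSigma i)
    then show ?thesis using Cons.prems assms(1) that[of "Sigma i k"]
      by (auto simp: mv_gens_def)
  next
    case (MRho i \<beta>)
    then show ?thesis using Cons.prems that[of "if \<beta> = 0 then Rho i else Sigma i \<beta>"]
      by (cases "\<beta> = 0") (auto simp: mv_gens_def)
  qed
  with u show ?case
    by (intro bexI[of _ "(x, snd p) # u"]) (auto simp: q_word_def)
qed (auto simp: q_word_def intro!: bexI[of _ "[]"])

theorem q_map_epi:
  assumes "k \<ge> 1"
  shows "q_map n k \<in> epi (UV n k) (MVB n k)"
proof -
  have q: "q_word k w \<in> words (mv_gens n k)" if "w \<in> words (uv_gens n k)" for w
    using q_word_cong[OF assms] word_cong.refl that word_cong_words by metis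
  have "q_map n k \<in> hom (UV n k) (MVB n k)"
    by (intro homI) (auto simp: UV_def MVB_def carrier_presented_group q_map_word_class[OF assms] q
        word_class_mult q_word_def[of k "_ @ _"] simp flip: q_word_def)
  moreover have "q_map n k ` carrier (UV n k) = carrier (MVB n k)"
    using q q_word_surj[OF assms]
    by (force simp: UV_def MVB_def carrier_presented_group q_map_word_class[OF assms])
  ultimately show ?thesis by (auto simp: epi_def)
qed

lemma Inn_normal:
  assumes "group G"
  shows "Inn G \<lhd> AutoGroup G"
proof -
  interpret G: group G by (rule assms)
  interpret A: group "AutoGroup G" by (rule G.AutoGroup)
  have ia: "inner_auto G g \<in> auto G" if "g \<in> carrier G" for g
  proof -
    have cancel: "inv\<^bsub>G\<^esub> g \<otimes>\<^bsub>G\<^esub> (g \<otimes>\<^bsub>G\<^esub> a) = a" "g \<otimes>\<^bsub>G\<^esub> (inv\<^bsub>G\<^esub> g \<otimes>\<^bsub>G\<^esub> a) = a"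
      if "a \<in> carrier G" for a
      using that \<open>g \<in> carrier G\<close> by (simp_all flip: G.m_assoc)
    have "bij_betw (inner_auto G g) (carrier G) (carrier G)"
      by (rule bij_betw_byWitness[where f' = "inner_auto G (inv\<^bsub>G\<^esub> g)"])
        (use that in \<open>auto simp: inner_auto_def G.m_assoc cancel\<close>)
    moreover have "inner_auto G g \<in> hom G G"
      using that by (intro homI) (auto simp: inner_auto_def G.m_assoc G.inv_solve_left)
    ultimately show ?thesis by (auto simp: auto_def Bij_def inner_auto_def)
  qed
  have mult: "\<alpha> \<otimes>\<^bsub>AutoGroup G\<^esub> \<beta> = compose (carrier G) \<alpha> \<beta>" if "\<alpha> \<in> auto G" "\<beta> \<in> auto G" for \<alpha> \<beta>
    using that by (simp add: AutoGroup_def BijGroup_def auto_def)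
  have carr: "carrier (AutoGroup G) = auto G" by (simp add: AutoGroup_def)
  have "inner_auto G g \<otimes>\<^bsub>AutoGroup G\<^esub> inner_auto G h = inner_auto G (g \<otimes>\<^bsub>G\<^esub> h)"
    if "g \<in> carrier G" "h \<in> carrier G" for g h
    unfolding mult[OF ia[OF that(1)] ia[OF that(2)]]
    using that by (auto simp: inner_auto_def compose_def G.m_assoc G.inv_mult_group)
  then have "group_hom G (AutoGroup G) (inner_auto G)"
    using ia carr by unfold_locales (auto intro!: homI)
  then have sub: "subgroup (Inn G) (AutoGroup G)"
    unfolding Inn_def by (rule group_hom.img_is_subgroup)
  have "\<alpha> \<otimes>\<^bsub>AutoGroup G\<^esub> \<iota> \<otimes>\<^bsub>AutoGroup G\<^esub> inv\<^bsub>AutoGroup G\<^esub> \<alpha> \<in> Inn G"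
    if \<alpha>: "\<alpha> \<in> auto G" and \<iota>: "\<iota> \<in> Inn G" for \<alpha> \<iota>
  proof -
    obtain g where g: "g \<in> carrier G" "\<iota> = inner_auto G g" using \<iota> by (auto simp: Inn_def)
    interpret h: group_hom G G \<alpha> using \<alpha> by unfold_locales (auto simp: auto_def)
    have "\<alpha> \<otimes>\<^bsub>AutoGroup G\<^esub> \<iota> = inner_auto G (\<alpha> g) \<otimes>\<^bsub>AutoGroup G\<^esub> \<alpha>"
      using \<alpha> g ia by (auto simp: mult inner_auto_def compose_def)
    then have "\<alpha> \<otimes>\<^bsub>AutoGroup G\<^esub> \<iota> \<otimes>\<^bsub>AutoGroup G\<^esub> inv\<^bsub>AutoGroup G\<^esub> \<alpha> = inner_auto G (\<alpha> g)"
      using \<alpha> ia[OF h.hom_closed[OF g(1)]] unfolding carr[symmetric] by (simp add: A.m_assoc)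
    then show ?thesis using g by (simp add: Inn_def)
  qed
  with sub show ?thesis by (simp add: A.normal_inv_iff carr)
qed

lemma group_Out: "group G \<Longrightarrow> group (Out G)"
  unfolding Out_def by (intro normal.factorgroup_is_group Inn_normal)

end

theory Submission
  imports Defs
begin

text \<open>
  Descending. Since \<open>q\<close> is the quotient by the involution relations for the colours \<open>t < k\<close> and the
  braid relations for all colours, an automorphism \<open>\<alpha>\<close> of \<open>UV\<^sub>n(k)\<close> induces an endomorphism as
  soon as the elements \<open>q (\<alpha> (\<sigma>\<^sub>i\<^sub>,\<^sub>t))\<close> satisfy these relations, and \<open>q\<close> being onto turns
  \<open>\<alpha>\<^sup>2 = 1\<close> and \<open>\<alpha> \<beta> = \<beta> \<alpha>\<close> into the same identities downstairs (\<open>involution_descends\<close>,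
  \<open>commute_on_descends\<close>). Inverting both sides of a relation gives the case of \<open>\<theta>\<close>. For \<open>\<zeta>\<^sub>l\<close> the
  point is that conjugation by \<open>\<rho>\<^sub>i \<rho>\<^sub>i\<^sub>+\<^sub>1 \<rho>\<^sub>i\<close> exchanges \<open>\<sigma>\<^sub>i\<close> with
  \<open>\<rho>\<^sub>i\<^sub>+\<^sub>1 \<sigma>\<^sub>i\<^sub>+\<^sub>1 \<rho>\<^sub>i\<^sub>+\<^sub>1\<close>, and \<open>\<sigma>\<^sub>i\<^sub>+\<^sub>1\<close> with \<open>\<rho>\<^sub>i \<sigma>\<^sub>i \<rho>\<^sub>i\<close>: the braid relation
  for the conjugated generators is itself a conjugate of the original one (\<open>conj_braid\<close>).

  Outer classes. The images of \<open>\<theta>\<close> and \<open>\<zeta>\<^sub>k\<close> are commuting involutions, so their classes generate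
  \<open>\<int>\<^sub>2 \<times> \<int>\<^sub>2\<close> once both classes are nontrivial and distinct
  (\<open>commuting_involutions_generate_Klein_four\<close>). The exponent sum in the \<open>\<sigma>\<^sub>i\<close> is a homomorphism to
  \<open>\<int>\<close>; it is blind to inner automorphisms, is negated by \<open>\<theta>\<close> and preserved by \<open>\<zeta>\<^sub>k\<close>.
  This settles everything except that \<open>\<zeta>\<^sub>k\<close> is not inner, which abelian quotients
  do not see. An inner automorphism maps every normal subgroup onto itself, so it suffices
  to exhibit a normal subgroup that \<open>\<zeta>\<^sub>k\<close> moves. Take the kernel of the action on integer
  sequences in which \<open>\<rho>\<^sub>i\<close> swaps two neighbours and \<open>\<sigma>\<^sub>i\<close> sends \<open>(a, b)\<close> to \<open>(b, 2b - a)\<close>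
  (colouring by the dihedral quandle). As for welded braids, one of the two so-called forbidden
  moves, \<open>\<sigma>\<^sub>1 \<sigma>\<^sub>2 \<rho>\<^sub>1 = \<rho>\<^sub>2 \<sigma>\<^sub>1 \<sigma>\<^sub>2\<close>, holds for this action; its
  image under \<open>\<zeta>\<^sub>k\<close> does not (\<open>zeta_not_inner\<close>).
\<close>

section \<open>Homomorphisms out of the two groups\<close>

lemma uv_rels_words:
  assumes "(u, v) \<in> uv_rels n k"
  shows "u \<in> words (uv_gens n k)" "v \<in> words (uv_gens n k)"
  using assms by (auto simp: uv_rels_def pos_def)

lemma word_eval_q_word: "word_eval H f (q_word k w) = word_eval H (f \<circ> q_gen k) w"
  by (induction w) (auto simp: q_word_def)

text \<open>
  The universal property of \<open>q\<close> as a quotient map. Starting from a homomorphism on \<open>UV\<^sub>n(k)\<close>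
  rather than from images of generators, only the relations added by \<open>q\<close> are left to check.
\<close>

lemma hom_factors_through_q_map:
  assumes H: "group H" and k: "k \<ge> 1" and \<phi>: "\<phi> \<in> hom (UV n k) H"
    and inv: "\<And>i t. i \<in> {1..<n} \<Longrightarrow> t \<in> {1..<k} \<Longrightarrow>
      \<phi> (uv_sigma n k i t) \<otimes>\<^bsub>H\<^esub> \<phi> (uv_sigma n k i t) = \<one>\<^bsub>H\<^esub>"
    and braid: "\<And>i t. i \<in> {1..<n} \<Longrightarrow> i + 1 < n \<Longrightarrow> t \<in> {1..k} \<Longrightarrow>
      \<phi> (uv_sigma n k i t) \<otimes>\<^bsub>H\<^esub> (\<phi> (uv_sigma n k (i+1) t) \<otimes>\<^bsub>H\<^esub> \<phi> (uv_sigma n k i t))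
      = \<phi> (uv_sigma n k (i+1) t) \<otimes>\<^bsub>H\<^esub> (\<phi> (uv_sigma n k i t) \<otimes>\<^bsub>H\<^esub> \<phi> (uv_sigma n k (i+1) t))"
  shows "\<exists>\<psi>\<in>hom (MVB n k) H. \<forall>x\<in>carrier (UV n k). \<psi> (q_map n k x) = \<phi> x"
proof -
  interpret H: group H by (rule H)
  define f where "f y = (case y of
      MSigma i \<Rightarrow> \<phi> (uv_sigma n k i k)
    | MRho i \<beta> \<Rightarrow> if \<beta> = 0 then \<phi> (uv_rho n k i) else \<phi> (uv_sigma n k i \<beta>))" for y
  have cl: "\<phi> x \<in> carrier H" if "x \<in> carrier (UV n k)" for x
    using \<phi> that by (auto simp: hom_def)
  have f: "f ` mv_gens n k \<subseteq> carrier H"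
    using k by (auto simp: f_def mv_gens_def intro!: cl)
  have fq: "(f \<circ> q_gen k) x = \<phi> (word_class (uv_gens n k) (uv_rels n k) [(x, True)])"
    if "x \<in> uv_gens n k" for x
    using that by (auto simp: f_def uv_gens_def uv_rho_def uv_sigma_def pos_def)
  have eval: "word_eval H f (q_word k w) = \<phi> (word_class (uv_gens n k) (uv_rels n k) w)"
    if "w \<in> words (uv_gens n k)" for w
    unfolding word_eval_q_word hom_eq_word_eval[OF H \<phi>[unfolded UV_def] that]
    using fq that by (rule word_eval_fun_cong)
  have uv: "word_eval H f (q_word k u) = word_eval H f (q_word k v)"
    if "(u, v) \<in> uv_rels n k" for u v
  proof -
    note w = uv_rels_words[OF that]
    have "word_class (uv_gens n k) (uv_rels n k) u = word_class (uv_gens n k) (uv_rels n k) v"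
      using word_class_eq_iff[OF w] word_cong.rel[OF that w] by blast
    then show ?thesis using w by (simp add: eval)
  qed
  have inv': "f (MRho i t) \<otimes>\<^bsub>H\<^esub> f (MRho i t) = \<one>\<^bsub>H\<^esub>"
    if "i \<in> {1..<n}" "t \<in> {1..<k}" for i t
    using inv[OF that] that by (simp add: f_def)
  have "word_eval H f u = word_eval H f v" if "(u, v) \<in> mv_rels n k" for u v
    using that unfolding mv_rels_def
  proof (elim UnE CollectE exE conjE Pair_inject)
    fix i t assume "u = pos [MRho i t, MRho i t]" "v = []" and i: "i \<in> {1..<n}" "t \<in> {1..<k}"
    then show ?thesis using inv[OF i] i by (simp add: pos_def f_def cl)
  next
    fix i t assume "u = pos [MRho i t, MRho (i+1) t, MRho i t]"
      "v = pos [MRho (i+1) t, MRho i t, MRho (i+1) t]"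
      and i: "i \<in> {1..<n}" "i + 1 < n" "t \<in> {1..<k}"
    then show ?thesis using braid[of i t] by (simp add: pos_def f_def cl)
  next
    fix i assume "u = pos [MSigma i, MSigma (i+1), MSigma i]"
      "v = pos [MSigma (i+1), MSigma i, MSigma (i+1)]" and i: "i \<in> {1..<n}" "i + 1 < n"
    then show ?thesis using braid[of i k] k by (simp add: pos_def f_def cl)
  qed (simp add: uv)
  from presented_group_hom[OF H f, of "mv_rels n k", OF this]
  obtain \<psi> where \<psi>: "\<psi> \<in> hom (MVB n k) H"
    "\<And>w. w \<in> words (mv_gens n k) \<Longrightarrow>
      \<psi> (word_class (mv_gens n k) (mv_rels n k) w) = word_eval H f w"
    by (auto simp: MVB_def)
  have "\<psi> (q_map n k x) = \<phi> x" if x: "x \<in> carrier (UV n k)" for x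
  proof -
    obtain w where w: "w \<in> words (uv_gens n k)" "x = word_class (uv_gens n k) (uv_rels n k) w"
      using x by (auto simp: UV_def carrier_presented_group)
    have "q_word k w \<in> words (mv_gens n k)"
      using q_word_cong[OF k word_cong.refl[OF w(1)]] word_cong_words by blast
    then show ?thesis using w by (simp add: q_map_word_class[OF k] \<psi>(2) eval)
  qed
  with \<psi>(1) show ?thesis by blast
qed

text \<open>
  Constructs representations. Treating \<open>\<rho>\<^sub>i\<close> as the generator \<open>g i 0\<close> of colour \<open>0\<close> and
  \<open>\<sigma>\<^sub>i\<^sub>,\<^sub>t\<close> as the one of colour \<open>t\<close> makes the defining relations uniform in the colours: only
  colour \<open>k\<close> is exempt from being an involution.
\<close>

lemma MVB_hom_exists:
  assumes H: "group H" and k: "k \<ge> 1"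
    and closed: "\<And>i t. i \<in> {1..<n} \<Longrightarrow> t \<le> k \<Longrightarrow> g i t \<in> carrier H"
    and inv: "\<And>i t. i \<in> {1..<n} \<Longrightarrow> t < k \<Longrightarrow> g i t \<otimes>\<^bsub>H\<^esub> g i t = \<one>\<^bsub>H\<^esub>"
    and braid: "\<And>i t. i \<in> {1..<n} \<Longrightarrow> i + 1 < n \<Longrightarrow> t \<le> k \<Longrightarrow>
      g i t \<otimes>\<^bsub>H\<^esub> (g (i+1) t \<otimes>\<^bsub>H\<^esub> g i t) = g (i+1) t \<otimes>\<^bsub>H\<^esub> (g i t \<otimes>\<^bsub>H\<^esub> g (i+1) t)"
    and far: "\<And>i j t l. i \<in> {1..<n} \<Longrightarrow> j \<in> {1..<n} \<Longrightarrow> far i j \<Longrightarrow> t \<le> k \<Longrightarrow> l \<le> k \<Longrightarrow>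
      g i t \<otimes>\<^bsub>H\<^esub> g j l = g j l \<otimes>\<^bsub>H\<^esub> g i t"
    and mixed: "\<And>i t. i \<in> {1..<n} \<Longrightarrow> i + 1 < n \<Longrightarrow> 1 \<le> t \<Longrightarrow> t \<le> k \<Longrightarrow>
      g i 0 \<otimes>\<^bsub>H\<^esub> (g (i+1) 0 \<otimes>\<^bsub>H\<^esub> g i t) = g (i+1) t \<otimes>\<^bsub>H\<^esub> (g i 0 \<otimes>\<^bsub>H\<^esub> g (i+1) 0)"
  shows "\<exists>\<psi>\<in>hom (MVB n k) H.
      (\<forall>i\<in>{1..<n}. \<psi> (q_map n k (uv_rho n k i)) = g i 0)
    \<and> (\<forall>i\<in>{1..<n}. \<forall>t\<in>{1..k}. \<psi> (q_map n k (uv_sigma n k i t)) = g i t)"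
proof -
  interpret H: group H by (rule H)
  define f where "f = case_uv_gen (\<lambda>i. g i 0) g"
  have f: "f ` uv_gens n k \<subseteq> carrier H"
    using closed by (auto simp: f_def uv_gens_def)
  have "word_eval H f u = word_eval H f v" if "(u, v) \<in> uv_rels n k" for u v
    using that k unfolding uv_rels_def
    by (elim UnE CollectE exE conjE Pair_inject; simp add: f_def pos_def closed inv
        braid[simplified] mixed[simplified]; intro far; simp)
  from presented_group_hom[OF H f, of "uv_rels n k", OF this]
  obtain \<phi> where \<phi>: "\<phi> \<in> hom (UV n k) H"
    "\<forall>w\<in>words (uv_gens n k). \<phi> (word_class (uv_gens n k) (uv_rels n k) w) = word_eval H f w"
    by (auto simp: UV_def)
  have r: "\<phi> (uv_rho n k i) = g i 0" if "i \<in> {1..<n}" for i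
    using \<phi>(2) that closed by (simp add: f_def pos_def uv_rho_def)
  have s: "\<phi> (uv_sigma n k i t) = g i t" if "i \<in> {1..<n}" "t \<in> {1..k}" for i t
    using \<phi>(2) that closed by (simp add: f_def pos_def uv_sigma_def)
  have "\<exists>\<psi>\<in>hom (MVB n k) H. \<forall>x\<in>carrier (UV n k). \<psi> (q_map n k x) = \<phi> x"
  proof (rule hom_factors_through_q_map[OF H k \<phi>(1)])
    fix i t assume "i \<in> {1..<n}" "i + 1 < n" "t \<in> {1..k}"
    then show "\<phi> (uv_sigma n k i t) \<otimes>\<^bsub>H\<^esub> (\<phi> (uv_sigma n k (i+1) t) \<otimes>\<^bsub>H\<^esub> \<phi> (uv_sigma n k i t))
      = \<phi> (uv_sigma n k (i+1) t) \<otimes>\<^bsub>H\<^esub> (\<phi> (uv_sigma n k i t) \<otimes>\<^bsub>H\<^esub> \<phi> (uv_sigma n k (i+1) t))"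
      using braid[of i t] by (simp add: s)
  qed (simp add: s inv)
  then obtain \<psi> where "\<psi> \<in> hom (MVB n k) H" "\<forall>x\<in>carrier (UV n k). \<psi> (q_map n k x) = \<phi> x"
    by blast
  then show ?thesis by (intro bexI[of _ \<psi>]) (simp_all add: r s)
qed

lemma MVB_sigma_sigma:
  assumes k: "k \<ge> 1" and i: "i \<in> {1..<n}" "t \<in> {1..<k}"
  shows "q_map n k (uv_sigma n k i t) \<otimes>\<^bsub>MVB n k\<^esub> q_map n k (uv_sigma n k i t) = \<one>\<^bsub>MVB n k\<^esub>"
proof -
  have g: "MRho i t \<in> mv_gens n k" using i by (auto simp: mv_gens_def)
  have "(pos [MRho i t, MRho i t], []) \<in> mv_rels n k" using i by (auto simp: mv_rels_def)
  then have "(pos [MRho i t, MRho i t], []) \<in> word_cong (mv_gens n k) (mv_rels n k)"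
    using g by (intro word_cong.rel) (auto simp: pos_def)
  then show ?thesis using i g
    by (simp add: uv_sigma_def q_map_word_class[OF k] pos_def q_word_def MVB_def
        word_class_mult word_class_one word_class_eq_iff)
qed

text \<open>
  For \<open>t < k\<close> and for \<open>t = k\<close> this is a different defining relation, as \<open>q\<close> sends colour \<open>k\<close> alone
  to the generators \<open>MSigma\<close>.
\<close>

lemma MVB_sigma_braid:
  assumes k: "k \<ge> 1" and i: "i \<in> {1..<n}" "i + 1 < n" "t \<in> {1..k}"
  defines "s \<equiv> \<lambda>j. q_map n k (uv_sigma n k j t)"
  shows "s i \<otimes>\<^bsub>MVB n k\<^esub> (s (i+1) \<otimes>\<^bsub>MVB n k\<^esub> s i) = s (i+1) \<otimes>\<^bsub>MVB n k\<^esub> (s i \<otimes>\<^bsub>MVB n k\<^esub> s (i+1))"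
proof -
  define x where "x j = q_gen k (Sigma j t)" for j
  have g: "x i \<in> mv_gens n k" "x (i+1) \<in> mv_gens n k"
    using i by (auto simp: mv_gens_def x_def)
  have "(pos [x i, x (i+1), x i], pos [x (i+1), x i, x (i+1)]) \<in> mv_rels n k"
  proof (cases "t = k")
    case True
    have "(pos [MSigma i, MSigma (i+1), MSigma i], pos [MSigma (i+1), MSigma i, MSigma (i+1)])
        \<in> mv_rels n k"
      unfolding mv_rels_def using i by blast
    then show ?thesis using True by (simp add: x_def)
  next
    case False
    then have "t \<in> {1..<k}" using i by simp
    then have "(pos [MRho i t, MRho (i+1) t, MRho i t], pos [MRho (i+1) t, MRho i t, MRho (i+1) t])
        \<in> mv_rels n k"
      unfolding mv_rels_def using i by blast
    then show ?thesis using False by (simp add: x_def)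
  qed
  then have "(pos [x i, x (i+1), x i], pos [x (i+1), x i, x (i+1)])
      \<in> word_cong (mv_gens n k) (mv_rels n k)"
    using g by (intro word_cong.rel) (auto simp: pos_def)
  moreover have "s j = word_class (mv_gens n k) (mv_rels n k) [(x j, True)]"
    if "j \<in> {1..<n}" for j
    using that i by (simp add: s_def uv_sigma_def q_map_word_class[OF k] pos_def q_word_def x_def)
  ultimately show ?thesis using i g
    by (simp add: pos_def MVB_def word_class_mult word_class_eq_iff)
qed

section \<open>Descending along the quotient map\<close>

lemma q_map_hom: "k \<ge> 1 \<Longrightarrow> group_hom (UV n k) (MVB n k) (q_map n k)"
  using q_map_epi[of k n] group_UV[of n k] group_MVB[of n k]
  by (simp add: group_hom_def group_hom_axioms_def epi_def)

lemma q_map_surj: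
  assumes "k \<ge> 1" "y \<in> carrier (MVB n k)"
  obtains x where "x \<in> carrier (UV n k)" "y = q_map n k x"
  using q_map_epi[of k n] assms by (auto simp: epi_def)

text \<open>
  The induced endomorphism is its own inverse because \<open>q\<close> is onto, hence an automorphism.
\<close>

lemma involution_descends:
  assumes k: "k \<ge> 1" and \<alpha>: "\<alpha> \<in> auto (UV n k)" "involutive_on (carrier (UV n k)) \<alpha>"
    and inv: "\<And>i t. i \<in> {1..<n} \<Longrightarrow> t \<in> {1..<k} \<Longrightarrow>
      q_map n k (\<alpha> (uv_sigma n k i t)) \<otimes>\<^bsub>MVB n k\<^esub> q_map n k (\<alpha> (uv_sigma n k i t)) = \<one>\<^bsub>MVB n k\<^esub>"
    and braid: "\<And>i t. i \<in> {1..<n} \<Longrightarrow> i + 1 < n \<Longrightarrow> t \<in> {1..k} \<Longrightarrow>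
      q_map n k (\<alpha> (uv_sigma n k i t)) \<otimes>\<^bsub>MVB n k\<^esub>
        (q_map n k (\<alpha> (uv_sigma n k (i+1) t)) \<otimes>\<^bsub>MVB n k\<^esub> q_map n k (\<alpha> (uv_sigma n k i t)))
      = q_map n k (\<alpha> (uv_sigma n k (i+1) t)) \<otimes>\<^bsub>MVB n k\<^esub>
        (q_map n k (\<alpha> (uv_sigma n k i t)) \<otimes>\<^bsub>MVB n k\<^esub> q_map n k (\<alpha> (uv_sigma n k (i+1) t)))"
  shows "\<exists>\<alpha>'. descends_to (UV n k) (MVB n k) (q_map n k) \<alpha> \<alpha>' \<and> involutive_on (carrier (MVB n k)) \<alpha>'"
proof -
  interpret q: group_hom "UV n k" "MVB n k" "q_map n k" by (rule q_map_hom[OF k])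
  have \<alpha>c: "\<alpha> x \<in> carrier (UV n k)" if "x \<in> carrier (UV n k)" for x
    using \<alpha>(1) that by (auto simp: auto_def hom_def)
  have "q_map n k \<circ> \<alpha> \<in> hom (UV n k) (MVB n k)"
    using \<alpha>(1) by (auto simp: auto_def intro: hom_compose q.homh)
  from hom_factors_through_q_map[OF group_MVB k this] inv braid
  obtain \<psi> where \<psi>: "\<psi> \<in> hom (MVB n k) (MVB n k)"
    "\<And>x. x \<in> carrier (UV n k) \<Longrightarrow> \<psi> (q_map n k x) = q_map n k (\<alpha> x)"
    by auto
  have \<psi>\<psi>: "\<psi> (\<psi> y) = y" if "y \<in> carrier (MVB n k)" for y
    using that \<alpha>(2) by (elim q_map_surj[OF k]) (simp add: \<psi>(2) \<alpha>c involutive_on_def)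
  have "restrict \<psi> (carrier (MVB n k)) \<in> auto (MVB n k)"
    by (rule hom_involution_auto[OF group_MVB \<psi>(1) \<psi>\<psi>])
  moreover have "\<psi> y \<in> carrier (MVB n k)" if "y \<in> carrier (MVB n k)" for y
    using \<psi>(1) that by (auto simp: hom_def)
  ultimately show ?thesis
    using \<alpha>(1) \<psi>\<psi> \<psi>(2)
    by (intro exI[of _ "restrict \<psi> (carrier (MVB n k))"])
      (auto simp: descends_to_def involutive_on_def)
qed

lemma commute_on_descends:
  assumes k: "k \<ge> 1" and "commute_on (carrier (UV n k)) \<alpha> \<beta>"
    and "descends_to (UV n k) (MVB n k) (q_map n k) \<alpha> \<alpha>'"
    and "descends_to (UV n k) (MVB n k) (q_map n k) \<beta> \<beta>'"
  shows "commute_on (carrier (MVB n k)) \<alpha>' \<beta>'"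
  unfolding commute_on_def
proof
  fix y assume "y \<in> carrier (MVB n k)"
  then obtain x where x: "x \<in> carrier (UV n k)" "y = q_map n k x" by (rule q_map_surj[OF k])
  moreover have "\<alpha> x \<in> carrier (UV n k)" "\<beta> x \<in> carrier (UV n k)"
    using assms(3,4) x(1) by (auto simp: descends_to_def auto_def hom_def)
  ultimately show "\<alpha>' (\<beta>' y) = \<beta>' (\<alpha>' y)"
    using assms(2-4) by (simp add: descends_to_def commute_on_def)
qed

section \<open>The automorphisms of the universal virtual braid group\<close>

lemma UV_commute_onI:
  assumes \<alpha>: "\<alpha> \<in> auto (UV n k)" and \<beta>: "\<beta> \<in> auto (UV n k)"
    and "\<And>i. i \<in> {1..<n} \<Longrightarrow> \<alpha> (\<beta> (uv_rho n k i)) = \<beta> (\<alpha> (uv_rho n k i))"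
    and "\<And>i t. i \<in> {1..<n} \<Longrightarrow> t \<in> {1..k} \<Longrightarrow> \<alpha> (\<beta> (uv_sigma n k i t)) = \<beta> (\<alpha> (uv_sigma n k i t))"
  shows "commute_on (carrier (UV n k)) \<alpha> \<beta>"
  unfolding commute_on_def
proof
  fix x assume x: "x \<in> carrier (UV n k)"
  have "(\<alpha> \<circ> \<beta>) x = (\<beta> \<circ> \<alpha>) x"
    by (rule UV_hom_eqI[OF _ _ _ _ x]) 
      (use assms in \<open>auto simp: auto_def hom_def Pi_iff\<close>)
  then show "\<alpha> (\<beta> x) = \<beta> (\<alpha> x)" by simp
qed

lemma UV_involutive_onI:
  assumes \<alpha>: "\<alpha> \<in> auto (UV n k)"
    and "\<And>i. i \<in> {1..<n} \<Longrightarrow> \<alpha> (\<alpha> (uv_rho n k i)) = uv_rho n k i"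
    and "\<And>i t. i \<in> {1..<n} \<Longrightarrow> t \<in> {1..k} \<Longrightarrow> \<alpha> (\<alpha> (uv_sigma n k i t)) = uv_sigma n k i t"
  shows "involutive_on (carrier (UV n k)) \<alpha>"
  unfolding involutive_on_def
proof
  fix x assume x: "x \<in> carrier (UV n k)"
  have "(\<alpha> \<circ> \<alpha>) x = (\<lambda>x. x) x"
    by (rule UV_hom_eqI[OF _ _ _ _ x])
      (use assms in \<open>auto simp: auto_def hom_def Pi_iff\<close>)
  then show "\<alpha> (\<alpha> x) = x" by simp
qed

section \<open>Conjugating generators by involutions\<close>

lemma (in group) conj_conj_involution:
  assumes "r \<in> carrier G" "s \<in> carrier G" "r \<otimes> r = \<one>"
  shows "r \<otimes> (r \<otimes> s \<otimes> r) \<otimes> r = s"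
proof -
  have "r \<otimes> (r \<otimes> s \<otimes> r) \<otimes> r = (r \<otimes> r) \<otimes> s \<otimes> (r \<otimes> r)"
    using assms(1,2) by (simp add: m_assoc)
  then show ?thesis using assms by simp
qed

lemma (in group) conj_square_involution:
  assumes "r \<in> carrier G" "s \<in> carrier G" "r \<otimes> r = \<one>" "s \<otimes> s = \<one>"
  shows "r \<otimes> s \<otimes> r \<otimes> (r \<otimes> s \<otimes> r) = \<one>"
proof -
  have "r \<otimes> s \<otimes> r \<otimes> (r \<otimes> s \<otimes> r) = r \<otimes> (s \<otimes> (r \<otimes> r) \<otimes> s) \<otimes> r"
    using assms(1,2) by (simp add: m_assoc)
  then show ?thesis using assms by simp
qed

text \<open>
  In the symmetric-group picture \<open>a\<close> and \<open>b\<close> are adjacent transpositions and \<open>x\<close>, \<open>y\<close> are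
  attached to the ordered pairs \<open>(1,2)\<close> and \<open>(2,3)\<close>; \<open>a x a\<close> and \<open>b y b\<close> belong to
  \<open>(2,1)\<close> and \<open>(3,2)\<close>. The transposition \<open>(1 3)\<close>, which is \<open>d = a b a\<close>, carries \<open>(1,2)\<close> to
  \<open>(3,2)\<close> and \<open>(2,3)\<close> to \<open>(2,1)\<close>, so conjugation by \<open>d\<close> turns the braid relation of
  \<open>x\<close>, \<open>y\<close> into the claim.
\<close>

lemma (in group) conj_braid:
  assumes c: "a \<in> carrier G" "b \<in> carrier G" "x \<in> carrier G" "y \<in> carrier G"
    and aa: "a \<otimes> a = \<one>" and bb: "b \<otimes> b = \<one>"
    and aba: "a \<otimes> (b \<otimes> a) = b \<otimes> (a \<otimes> b)"
    and abx: "a \<otimes> (b \<otimes> x) = y \<otimes> (a \<otimes> b)"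
    and xyx: "x \<otimes> (y \<otimes> x) = y \<otimes> (x \<otimes> y)"
  shows "a \<otimes> x \<otimes> a \<otimes> (b \<otimes> y \<otimes> b \<otimes> (a \<otimes> x \<otimes> a)) = b \<otimes> y \<otimes> b \<otimes> (a \<otimes> x \<otimes> a \<otimes> (b \<otimes> y \<otimes> b))"
proof -
  have aa': "a \<otimes> (a \<otimes> z) = z" and bb': "b \<otimes> (b \<otimes> z) = z" if "z \<in> carrier G" for z
    using that c aa bb by (simp_all flip: m_assoc)
  define d where "d = a \<otimes> (b \<otimes> a)"
  have d: "d \<in> carrier G" using c by (simp add: d_def)
  have dx: "d \<otimes> x = b \<otimes> y \<otimes> b \<otimes> d"
  proof -
    have "d \<otimes> x = b \<otimes> (a \<otimes> (b \<otimes> x))" using c by (simp add: d_def aba m_assoc)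
    also have "\<dots> = b \<otimes> y \<otimes> b \<otimes> (b \<otimes> (a \<otimes> b))" using c by (simp add: abx m_assoc bb')
    finally show ?thesis by (simp add: d_def aba)
  qed
  have bay: "b \<otimes> (a \<otimes> y) = x \<otimes> (b \<otimes> a)"
  proof -
    have "b \<otimes> (a \<otimes> y) = b \<otimes> (a \<otimes> ((y \<otimes> (a \<otimes> b)) \<otimes> (b \<otimes> a)))"
      using c by (simp add: m_assoc aa aa' bb bb')
    also have "\<dots> = x \<otimes> (b \<otimes> a)"
      using c by (simp add: m_assoc aa aa' bb bb' flip: abx)
    finally show ?thesis .
  qed
  have dy: "d \<otimes> y = a \<otimes> x \<otimes> a \<otimes> d"
  proof -
    have "d \<otimes> y = a \<otimes> (b \<otimes> (a \<otimes> y))" using c by (simp add: d_def m_assoc)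
    also have "\<dots> = a \<otimes> x \<otimes> a \<otimes> (a \<otimes> (b \<otimes> a))" using c by (simp add: bay m_assoc aa')
    finally show ?thesis by (simp add: d_def)
  qed
  \<comment> \<open>Applied to both orders of the pair, this conjugates each side of the braid relation.\<close>
  have move: "p \<otimes> (q \<otimes> p) \<otimes> d = d \<otimes> (v \<otimes> (u \<otimes> v))"
    if "d \<otimes> u = q \<otimes> d" "d \<otimes> v = p \<otimes> d"
      "p \<in> carrier G" "q \<in> carrier G" "u \<in> carrier G" "v \<in> carrier G" for p q u v
  proof -
    have "p \<otimes> (q \<otimes> p) \<otimes> d = p \<otimes> (q \<otimes> (d \<otimes> v))" using that d by (simp add: m_assoc)
    also have "\<dots> = p \<otimes> (q \<otimes> d \<otimes> v)" using that d by (simp add: m_assoc)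
    also have "\<dots> = p \<otimes> d \<otimes> (u \<otimes> v)"
      unfolding that(1)[symmetric] using that(3-) d by (simp add: m_assoc)
    also have "\<dots> = d \<otimes> (v \<otimes> (u \<otimes> v))"
      unfolding that(2)[symmetric] using that(3-) d by (simp add: m_assoc)
    finally show ?thesis .
  qed
  have "a \<otimes> x \<otimes> a \<otimes> (b \<otimes> y \<otimes> b \<otimes> (a \<otimes> x \<otimes> a)) \<otimes> d
      = b \<otimes> y \<otimes> b \<otimes> (a \<otimes> x \<otimes> a \<otimes> (b \<otimes> y \<otimes> b)) \<otimes> d"
    using move[OF dx dy] move[OF dy dx] c xyx by simp
  then show ?thesis
    by (subst (asm) right_cancel) (use c d in simp_all)
qed

section \<open>Outer automorphisms\<close>

lemma out_class_hom:
  assumes "group G"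
  shows "out_class G \<in> hom (AutoGroup G) (Out G)"
  using normal.r_coset_hom_Mod[OF Inn_normal[OF assms]]
  by (simp add: out_class_def[abs_def] Out_def)

lemma AutoGroup_mult:
  "\<alpha> \<in> auto G \<Longrightarrow> \<beta> \<in> auto G \<Longrightarrow> \<alpha> \<otimes>\<^bsub>AutoGroup G\<^esub> \<beta> = compose (carrier G) \<alpha> \<beta>"
  by (simp add: AutoGroup_def BijGroup_def auto_def)

lemma AutoGroup_one: "\<one>\<^bsub>AutoGroup G\<^esub> = (\<lambda>x\<in>carrier G. x)"
  by (simp add: AutoGroup_def BijGroup_def)

lemma AutoGroup_carrier: "carrier (AutoGroup G) = auto G"
  by (simp add: AutoGroup_def)

lemma out_class_eqD:
  assumes G: "group G" and \<alpha>: "\<alpha> \<in> auto G" and \<beta>: "\<beta> \<in> auto G"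
    and eq: "out_class G \<alpha> = out_class G \<beta>"
  obtains g where "g \<in> carrier G"
    "\<And>x. x \<in> carrier G \<Longrightarrow> \<alpha> x = g \<otimes>\<^bsub>G\<^esub> \<beta> x \<otimes>\<^bsub>G\<^esub> inv\<^bsub>G\<^esub> g"
proof -
  interpret N: normal "Inn G" "AutoGroup G" by (rule Inn_normal[OF G])
  have "\<alpha> \<in> out_class G \<alpha>"
    using \<alpha> N.subgroup_axioms by (simp add: out_class_def N.rcos_self AutoGroup_carrier)
  then obtain \<iota> where \<iota>: "\<iota> \<in> Inn G" "\<alpha> = \<iota> \<otimes>\<^bsub>AutoGroup G\<^esub> \<beta>"
    unfolding eq by (auto simp: out_class_def r_coset_def)
  then obtain g where g: "g \<in> carrier G" "\<iota> = inner_auto G g" by (auto simp: Inn_def)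
  have "\<iota> \<in> auto G" using N.subset \<iota>(1) by (auto simp: AutoGroup_carrier)
  then have "\<alpha> x = g \<otimes>\<^bsub>G\<^esub> \<beta> x \<otimes>\<^bsub>G\<^esub> inv\<^bsub>G\<^esub> g" if "x \<in> carrier G" for x
    using \<beta> that by (auto simp: \<iota>(2) AutoGroup_mult g(2) inner_auto_def compose_def auto_def hom_def)
  with g(1) show ?thesis by (rule that)
qed

lemma out_class_eq_oneD:
  assumes G: "group G" and \<alpha>: "\<alpha> \<in> auto G" and eq: "out_class G \<alpha> = \<one>\<^bsub>Out G\<^esub>"
  obtains g where "g \<in> carrier G"
    "\<And>x. x \<in> carrier G \<Longrightarrow> \<alpha> x = g \<otimes>\<^bsub>G\<^esub> x \<otimes>\<^bsub>G\<^esub> inv\<^bsub>G\<^esub> g"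
proof -
  interpret G: group G by (rule G)
  have one: "\<one>\<^bsub>AutoGroup G\<^esub> \<in> auto G"
    using monoid.one_closed[OF group.is_monoid[OF G.AutoGroup]] by (simp add: AutoGroup_carrier)
  have "out_class G \<one>\<^bsub>AutoGroup G\<^esub> = \<one>\<^bsub>Out G\<^esub>"
    using hom_one[OF out_class_hom[OF G] G.AutoGroup group_Out[OF G]] .
  with eq have "out_class G \<alpha> = out_class G \<one>\<^bsub>AutoGroup G\<^esub>" by simp
  then obtain g where "g \<in> carrier G"
    "\<And>x. x \<in> carrier G \<Longrightarrow> \<alpha> x = g \<otimes>\<^bsub>G\<^esub> \<one>\<^bsub>AutoGroup G\<^esub> x \<otimes>\<^bsub>G\<^esub> inv\<^bsub>G\<^esub> g"
    by (rule out_class_eqD[OF G \<alpha> one]) blast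
  then show ?thesis by (intro that[of g]) (simp_all add: AutoGroup_one)
qed

text \<open>
  Conjugation is invisible in an abelian group.
\<close>

lemma integer_hom_out_class_invariant:
  assumes G: "group G" and \<epsilon>: "\<epsilon> \<in> hom G integer_group"
    and \<alpha>: "\<alpha> \<in> auto G" and \<beta>: "\<beta> \<in> auto G"
    and eq: "out_class G \<alpha> = out_class G \<beta>" and x: "x \<in> carrier G"
  shows "\<epsilon> (\<alpha> x) = \<epsilon> (\<beta> x)"
proof -
  interpret \<epsilon>: group_hom G integer_group \<epsilon>
    using G \<epsilon> by (simp add: group_hom_def group_hom_axioms_def)
  obtain g where "g \<in> carrier G"
    "\<And>x. x \<in> carrier G \<Longrightarrow> \<alpha> x = g \<otimes>\<^bsub>G\<^esub> \<beta> x \<otimes>\<^bsub>G\<^esub> inv\<^bsub>G\<^esub> g"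
    by (rule out_class_eqD[OF G \<alpha> \<beta> eq]) blast
  moreover have "\<beta> x \<in> carrier G" using \<beta> x by (auto simp: auto_def hom_def)
  ultimately show ?thesis using x by simp
qed

text \<open>
  The homomorphism \<open>(i, j) \<mapsto> a\<^sup>i b\<^sup>j\<close> has image generated by \<open>a\<close> and \<open>b\<close>. It is injective because
  \<open>a b = 1\<close> would force \<open>a = b\<close>.
\<close>

lemma (in group) commuting_involutions_generate_Klein_four:
  assumes ab: "a \<in> carrier G" "b \<in> carrier G" and aa: "a \<otimes> a = \<one>" and bb: "b \<otimes> b = \<one>"
    and comm: "a \<otimes> b = b \<otimes> a" and ne: "a \<noteq> \<one>" "b \<noteq> \<one>" "a \<noteq> b"
  shows "subgroup_generated G {a, b} \<cong> integer_mod_group 2 \<times>\<times> integer_mod_group 2"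
proof -
  let ?V = "integer_mod_group 2 \<times>\<times> integer_mod_group 2"
  define h where "h p = (if fst p = 0 then \<one> else a) \<otimes> (if snd p = 0 then \<one> else b)"
    for p :: "int \<times> int"
  have V: "group ?V" by (intro DirProd_group group_integer_mod_group)
  have range2: "{0..<2} = {0, 1::int}" by auto
  have carrier: "carrier ?V = {0, 1} \<times> {0, 1}"
    by (simp add: DirProd_def carrier_integer_mod_group range2)
  have aa': "a \<otimes> (a \<otimes> z) = z" and bb': "b \<otimes> (b \<otimes> z) = z" and ba: "b \<otimes> (a \<otimes> z) = a \<otimes> (b \<otimes> z)"
    if "z \<in> carrier G" for z
    using that ab aa bb comm by (simp_all flip: m_assoc)
  have "h \<in> hom ?V G"
  proof (rule homI)
    fix p q assume "p \<in> carrier ?V" "q \<in> carrier ?V"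
    then show "h (p \<otimes>\<^bsub>?V\<^esub> q) = h p \<otimes> h q"
      unfolding carrier using ab
      by (elim SigmaE insertE emptyE; simp add: h_def aa bb comm[symmetric] aa' bb' ba m_assoc)
  qed (use ab in \<open>simp add: h_def\<close>)
  then interpret h: group_hom ?V G h
    using V by (simp add: group_hom_def group_hom_axioms_def)
  have "a \<otimes> b \<noteq> \<one>" using aa'[OF ab(2)] ab(1) ne(3) by auto
  moreover have "a \<otimes> b \<noteq> a" "a \<otimes> b \<noteq> b" using ab ne by auto
  ultimately have "inj_on h (carrier ?V)"
    unfolding carrier using ab ne by (auto simp: inj_on_def h_def)
  moreover have "h ` carrier ?V = generate G {a, b}"
  proof
    have "h ` carrier ?V = {\<one>, a, b, a \<otimes> b}"
      unfolding carrier using ab by (auto simp: h_def image_iff)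
    then show "h ` carrier ?V \<subseteq> generate G {a, b}"
      by (auto intro: generate.intros)
    show "generate G {a, b} \<subseteq> h ` carrier ?V"
      using ab \<open>h ` carrier ?V = {\<one>, a, b, a \<otimes> b}\<close>
      by (intro generate_subgroup_incl h.img_is_subgroup) auto
  qed
  ultimately have "h \<in> iso ?V (subgroup_generated G {a, b})"
    using h.homh ab
    by (auto simp: iso_def bij_betw_def hom_def carrier_subgroup_generated)
  then have "?V \<cong> subgroup_generated G {a, b}" by (auto simp: is_iso_def)
  then show ?thesis using group.iso_sym[OF V] by blast
qed

section \<open>Two representations\<close>

text \<open>
  Every defining relation is balanced in the \<open>\<sigma>\<^sub>i\<close>, and the generators of the other colours are
  sent to \<open>0\<close>, as their being involutions requires.
\<close>

lemma MVB_sigma_exponent: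
  assumes k: "k \<ge> 1"
  shows "\<exists>\<epsilon>\<in>hom (MVB n k) integer_group.
      (\<forall>i\<in>{1..<n}. \<epsilon> (q_map n k (uv_rho n k i)) = 0)
    \<and> (\<forall>i\<in>{1..<n}. \<epsilon> (q_map n k (uv_sigma n k i k)) = 1)"
proof -
  have "\<exists>\<psi>\<in>hom (MVB n k) integer_group.
      (\<forall>i\<in>{1..<n}. \<psi> (q_map n k (uv_rho n k i)) = (if (0::nat) = k then 1 else 0))
    \<and> (\<forall>i\<in>{1..<n}. \<forall>t\<in>{1..k}. \<psi> (q_map n k (uv_sigma n k i t)) = (if t = k then 1 else 0))"
    by (rule MVB_hom_exists[OF group_integer_group k]) (auto simp: algebra_simps)
  then show ?thesis using k by fastforce
qed

definition act_at :: "nat \<Rightarrow> (int \<times> int \<Rightarrow> int \<times> int) \<Rightarrow> (nat \<Rightarrow> int) \<Rightarrow> nat \<Rightarrow> int" where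
  "act_at i F v = v(i := fst (F (v i, v (i+1))), i+1 := snd (F (v i, v (i+1))))"

text \<open>
  The braiding of the dihedral quandle \<open>a * b = 2b - a\<close> on the integers. It satisfies the braid
  relation by self-distributivity, \<open>(a * b) * c = (a * c) * (b * c)\<close>.
\<close>

definition dihedral :: "int \<times> int \<Rightarrow> int \<times> int" where
  "dihedral p = (snd p, 2 * snd p - fst p)"

lemma act_at_comp: "act_at i F \<circ> act_at i F' = act_at i (F \<circ> F')"
  by (auto simp: act_at_def fun_eq_iff)

lemma act_at_id: "act_at i id = id"
  by (auto simp: act_at_def fun_eq_iff)

lemma act_at_far: "far i j \<Longrightarrow> act_at i F \<circ> act_at j F' = act_at j F' \<circ> act_at i F"
  by (auto simp: act_at_def fun_eq_iff far_def)

lemma bij_act_at: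
  assumes "bij F"
  shows "bij (act_at i F)"
proof (rule o_bij)
  show "act_at i (inv_into UNIV F) \<circ> act_at i F = id" "act_at i F \<circ> act_at i (inv_into UNIV F) = id"
    using bij_is_inj[OF assms] bij_is_surj[OF assms]
    by (simp_all add: act_at_comp act_at_id surj_iff[THEN iffD1])
qed

lemma bij_dihedral: "bij dihedral"
  by (rule o_bij[where g = "\<lambda>p. (2 * fst p - snd p, fst p)"]) (auto simp: dihedral_def)

lemma BijGroup_UNIV_simps:
  "carrier (BijGroup UNIV) = {f. bij f}"
  "bij f \<Longrightarrow> bij g \<Longrightarrow> f \<otimes>\<^bsub>BijGroup UNIV\<^esub> g = f \<circ> g"
  "\<one>\<^bsub>BijGroup UNIV\<^esub> = id"
  by (auto simp: BijGroup_def Bij_def compose_def fun_eq_iff)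

text \<open>
  Colours below \<open>k\<close> all act as the swap, so they satisfy the relations of the symmetric group;
  the mixed relations express that swapping strands commutes with applying the quandle operation.
\<close>

lemma MVB_dihedral_action:
  assumes k: "k \<ge> 1"
  shows "\<exists>\<psi>\<in>hom (MVB n k) (BijGroup UNIV).
      (\<forall>i\<in>{1..<n}. \<psi> (q_map n k (uv_rho n k i)) = act_at i prod.swap)
    \<and> (\<forall>i\<in>{1..<n}. \<psi> (q_map n k (uv_sigma n k i k)) = act_at i dihedral)"
proof -
  define F where "F t = (if t < k then prod.swap else dihedral)" for t
  have F: "bij (F t)" for t by (simp add: F_def bij_dihedral)
  note B = bij_act_at[OF F]
  have "\<exists>\<psi>\<in>hom (MVB n k) (BijGroup UNIV).
      (\<forall>i\<in>{1..<n}. \<psi> (q_map n k (uv_rho n k i)) = act_at i (F 0))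
    \<and> (\<forall>i\<in>{1..<n}. \<forall>t\<in>{1..k}. \<psi> (q_map n k (uv_sigma n k i t)) = act_at i (F t))"
  proof (rule MVB_hom_exists[OF group_BijGroup k])
    fix i t assume "t < k"
    then have "F t \<circ> F t = id" by (simp add: F_def)
    then show "act_at i (F t) \<otimes>\<^bsub>BijGroup UNIV\<^esub> act_at i (F t) = \<one>\<^bsub>BijGroup UNIV\<^esub>"
      by (simp add: BijGroup_UNIV_simps B act_at_comp act_at_id)
  next
    fix i t
    show "act_at i (F t) \<otimes>\<^bsub>BijGroup UNIV\<^esub> (act_at (i+1) (F t) \<otimes>\<^bsub>BijGroup UNIV\<^esub> act_at i (F t))
        = act_at (i+1) (F t) \<otimes>\<^bsub>BijGroup UNIV\<^esub> (act_at i (F t) \<otimes>\<^bsub>BijGroup UNIV\<^esub> act_at (i+1) (F t))"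
      by (simp only: BijGroup_UNIV_simps B bij_comp)
        (auto simp: F_def act_at_def dihedral_def fun_eq_iff)
    show "act_at i (F 0) \<otimes>\<^bsub>BijGroup UNIV\<^esub> (act_at (i+1) (F 0) \<otimes>\<^bsub>BijGroup UNIV\<^esub> act_at i (F t))
        = act_at (i+1) (F t) \<otimes>\<^bsub>BijGroup UNIV\<^esub> (act_at i (F 0) \<otimes>\<^bsub>BijGroup UNIV\<^esub> act_at (i+1) (F 0))"
      using k by (simp only: BijGroup_UNIV_simps B bij_comp)
        (auto simp: F_def act_at_def dihedral_def fun_eq_iff)
  next
    fix i j t l assume "far i j"
    then show "act_at i (F t) \<otimes>\<^bsub>BijGroup UNIV\<^esub> act_at j (F l)
        = act_at j (F l) \<otimes>\<^bsub>BijGroup UNIV\<^esub> act_at i (F t)"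
      by (simp only: BijGroup_UNIV_simps B) (rule act_at_far)
  qed (simp add: BijGroup_UNIV_simps B)
  then show ?thesis using k by (fastforce simp: F_def)
qed

section \<open>The induced automorphisms\<close>

lemma theta_involutive:
  assumes "is_theta n k \<theta>"
  shows "involutive_on (carrier (UV n k)) \<theta>"
proof -
  interpret U: group "UV n k" by (rule group_UV)
  interpret h: group_hom "UV n k" "UV n k" \<theta>
    using assms by unfold_locales (simp add: is_theta_def auto_def)
  show ?thesis
    using assms by (intro UV_involutive_onI) (auto simp: is_theta_def)
qed

lemma zeta_involutive:
  assumes \<zeta>: "is_zeta n k l \<zeta>" and l: "l \<in> {1..k}"
  shows "involutive_on (carrier (UV n k)) \<zeta>"
proof (rule UV_involutive_onI)
  interpret U: group "UV n k" by (rule group_UV)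
  interpret h: group_hom "UV n k" "UV n k" \<zeta>
    using \<zeta> by unfold_locales (simp add: is_zeta_def auto_def)
  fix i t assume "i \<in> {1..<n}" "t \<in> {1..k}"
  then show "\<zeta> (\<zeta> (uv_sigma n k i t)) = uv_sigma n k i t"
    using \<zeta> l U.conj_conj_involution[OF _ _ rho_rho]
    by (cases "t = l") (auto simp: is_zeta_def)
qed (use \<zeta> in \<open>auto simp: is_zeta_def\<close>)

lemma theta_zeta_commute:
  assumes \<theta>: "is_theta n k \<theta>" and \<zeta>: "is_zeta n k l \<zeta>" and l: "l \<in> {1..k}"
  shows "commute_on (carrier (UV n k)) \<theta> \<zeta>"
proof (rule UV_commute_onI)
  interpret U: group "UV n k" by (rule group_UV)
  interpret \<theta>: group_hom "UV n k" "UV n k" \<theta>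
    using \<theta> by unfold_locales (simp add: is_theta_def auto_def)
  interpret \<zeta>: group_hom "UV n k" "UV n k" \<zeta>
    using \<zeta> by unfold_locales (simp add: is_zeta_def auto_def)
  fix i t assume it: "i \<in> {1..<n}" "t \<in> {1..k}"
  have r: "inv\<^bsub>UV n k\<^esub> uv_rho n k i = uv_rho n k i"
    using rho_rho[OF it(1)] it by (intro U.inv_equality) auto
  show "\<theta> (\<zeta> (uv_sigma n k i t)) = \<zeta> (\<theta> (uv_sigma n k i t))"
    using \<theta> \<zeta> it l
    by (cases "t = l") (auto simp: is_theta_def is_zeta_def U.inv_mult_group r U.m_assoc)
qed (use \<theta> \<zeta> in \<open>auto simp: is_theta_def is_zeta_def\<close>)

lemma zeta_zeta_commute:
  assumes \<zeta>: "is_zeta n k l \<zeta>" and \<zeta>': "is_zeta n k m \<zeta>'"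
    and l: "l \<in> {1..k}" and m: "m \<in> {1..k}"
  shows "commute_on (carrier (UV n k)) \<zeta> \<zeta>'"
proof (rule UV_commute_onI)
  interpret U: group "UV n k" by (rule group_UV)
  interpret \<zeta>: group_hom "UV n k" "UV n k" \<zeta>
    using \<zeta> by unfold_locales (simp add: is_zeta_def auto_def)
  interpret \<zeta>': group_hom "UV n k" "UV n k" \<zeta>'
    using \<zeta>' by unfold_locales (simp add: is_zeta_def auto_def)
  fix i t assume it: "i \<in> {1..<n}" "t \<in> {1..k}"
  show "\<zeta> (\<zeta>' (uv_sigma n k i t)) = \<zeta>' (\<zeta> (uv_sigma n k i t))"
    using \<zeta> \<zeta>' it l m
    by (cases "t = l"; cases "t = m") (auto simp: is_zeta_def)
qed (use \<zeta> \<zeta>' in \<open>auto simp: is_zeta_def\<close>)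

text \<open>
  Inverting both sides of an added relation inverts each letter and keeps the order, since
  \<open>s s\<close> and \<open>s t s\<close> are palindromes.
\<close>

lemma theta_descends:
  assumes k: "k \<ge> 1" and \<theta>: "is_theta n k \<theta>"
  shows "\<exists>\<theta>'. descends_to (UV n k) (MVB n k) (q_map n k) \<theta> \<theta>'
    \<and> involutive_on (carrier (MVB n k)) \<theta>'"
proof -
  interpret q: group_hom "UV n k" "MVB n k" "q_map n k" by (rule q_map_hom[OF k])
  let ?s = "\<lambda>i t. q_map n k (uv_sigma n k i t)"
  have \<theta>s: "q_map n k (\<theta> (uv_sigma n k i t)) = inv\<^bsub>MVB n k\<^esub> ?s i t"
    if "i \<in> {1..<n}" "t \<in> {1..k}" for i t
    using \<theta> that by (simp add: is_theta_def)
  show ?thesis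
  proof (rule involution_descends[OF k _ theta_involutive[OF \<theta>]])
    fix i t assume it: "i \<in> {1..<n}" "t \<in> {1..<k}"
    then have "inv\<^bsub>MVB n k\<^esub> ?s i t = ?s i t"
      using MVB_sigma_sigma[OF k it] by (intro q.H.inv_equality) auto
    then show "q_map n k (\<theta> (uv_sigma n k i t)) \<otimes>\<^bsub>MVB n k\<^esub> q_map n k (\<theta> (uv_sigma n k i t)) = \<one>\<^bsub>MVB n k\<^esub>"
      using it MVB_sigma_sigma[OF k it] by (simp add: \<theta>s)
  next
    fix i t assume it: "i \<in> {1..<n}" "i + 1 < n" "t \<in> {1..k}"
    have c: "?s i t \<in> carrier (MVB n k)" "?s (i+1) t \<in> carrier (MVB n k)" using it by auto
    show "q_map n k (\<theta> (uv_sigma n k i t)) \<otimes>\<^bsub>MVB n k\<^esub>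
        (q_map n k (\<theta> (uv_sigma n k (i+1) t)) \<otimes>\<^bsub>MVB n k\<^esub> q_map n k (\<theta> (uv_sigma n k i t)))
      = q_map n k (\<theta> (uv_sigma n k (i+1) t)) \<otimes>\<^bsub>MVB n k\<^esub>
        (q_map n k (\<theta> (uv_sigma n k i t)) \<otimes>\<^bsub>MVB n k\<^esub> q_map n k (\<theta> (uv_sigma n k (i+1) t)))"
      using arg_cong[OF MVB_sigma_braid[OF k it], of "m_inv (MVB n k)"] it c
      by (simp add: \<theta>s q.H.inv_mult_group q.H.m_assoc)
  qed (use \<theta> in \<open>simp add: is_theta_def\<close>)
qed

lemma zeta_descends:
  assumes k: "k \<ge> 1" and l: "l \<in> {1..k}" and \<zeta>: "is_zeta n k l \<zeta>"
  shows "\<exists>\<zeta>'. descends_to (UV n k) (MVB n k) (q_map n k) \<zeta> \<zeta>'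
    \<and> involutive_on (carrier (MVB n k)) \<zeta>'"
proof -
  interpret q: group_hom "UV n k" "MVB n k" "q_map n k" by (rule q_map_hom[OF k])
  let ?r = "\<lambda>i. q_map n k (uv_rho n k i)" and ?s = "\<lambda>i t. q_map n k (uv_sigma n k i t)"
  have \<zeta>l: "q_map n k (\<zeta> (uv_sigma n k i l)) = ?r i \<otimes>\<^bsub>MVB n k\<^esub> ?s i l \<otimes>\<^bsub>MVB n k\<^esub> ?r i"
    if "i \<in> {1..<n}" for i
    using \<zeta> that l by (simp add: is_zeta_def)
  have \<zeta>t: "q_map n k (\<zeta> (uv_sigma n k i t)) = ?s i t"
    if "i \<in> {1..<n}" "t \<in> {1..k}" "t \<noteq> l" for i t
    using \<zeta> that by (simp add: is_zeta_def)
  have rr: "?r i \<otimes>\<^bsub>MVB n k\<^esub> ?r i = \<one>\<^bsub>MVB n k\<^esub>" if "i \<in> {1..<n}" for i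
    using that by (simp add: rho_rho flip: q.hom_mult)
  show ?thesis
  proof (rule involution_descends[OF k _ zeta_involutive[OF \<zeta> l]])
    fix i t assume it: "i \<in> {1..<n}" "t \<in> {1..<k}"
    then show "q_map n k (\<zeta> (uv_sigma n k i t)) \<otimes>\<^bsub>MVB n k\<^esub> q_map n k (\<zeta> (uv_sigma n k i t)) = \<one>\<^bsub>MVB n k\<^esub>"
      using MVB_sigma_sigma[OF k it] q.H.conj_square_involution[OF _ _ rr MVB_sigma_sigma[OF k it]]
      by (cases "t = l") (simp_all add: \<zeta>l \<zeta>t)
  next
    fix i t assume it: "i \<in> {1..<n}" "i + 1 < n" "t \<in> {1..k}"
    show "q_map n k (\<zeta> (uv_sigma n k i t)) \<otimes>\<^bsub>MVB n k\<^esub>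
        (q_map n k (\<zeta> (uv_sigma n k (i+1) t)) \<otimes>\<^bsub>MVB n k\<^esub> q_map n k (\<zeta> (uv_sigma n k i t)))
      = q_map n k (\<zeta> (uv_sigma n k (i+1) t)) \<otimes>\<^bsub>MVB n k\<^esub>
        (q_map n k (\<zeta> (uv_sigma n k i t)) \<otimes>\<^bsub>MVB n k\<^esub> q_map n k (\<zeta> (uv_sigma n k (i+1) t)))"
    proof (cases "t = l")
      case True
      have i1: "i + 1 \<in> {1..<n}" using it by simp
      have "?r i \<otimes>\<^bsub>MVB n k\<^esub> (?r (i+1) \<otimes>\<^bsub>MVB n k\<^esub> ?r i)
          = ?r (i+1) \<otimes>\<^bsub>MVB n k\<^esub> (?r i \<otimes>\<^bsub>MVB n k\<^esub> ?r (i+1))"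
        using arg_cong[OF rho_braid[OF it(1,2), of k], of "q_map n k"] it(1) i1
        by (simp del: One_nat_def)
      moreover have "?r i \<otimes>\<^bsub>MVB n k\<^esub> (?r (i+1) \<otimes>\<^bsub>MVB n k\<^esub> ?s i l)
          = ?s (i+1) l \<otimes>\<^bsub>MVB n k\<^esub> (?r i \<otimes>\<^bsub>MVB n k\<^esub> ?r (i+1))"
        using arg_cong[OF rho_rho_sigma[OF it(1,2) l], of "q_map n k"] it(1) i1 l
        by (simp del: One_nat_def)
      ultimately show ?thesis
        unfolding True \<zeta>l[OF it(1)] \<zeta>l[OF i1]
        using it(1) i1 l MVB_sigma_braid[OF k it(1,2) l]
        by (intro q.H.conj_braid rr) auto
    next
      case False
      then show ?thesis using MVB_sigma_braid[OF k it] it by (simp add: \<zeta>t)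
    qed
  qed (use \<zeta> in \<open>simp add: is_zeta_def\<close>)
qed

text \<open>
  If \<open>\<zeta>'\<close> were inner, it would preserve the kernel of the dihedral action \<open>\<psi>\<close>. The
  words \<open>u = \<sigma>\<^sub>1 \<sigma>\<^sub>2 \<rho>\<^sub>1\<close> and \<open>v = \<rho>\<^sub>2 \<sigma>\<^sub>1 \<sigma>\<^sub>2\<close> both send \<open>(a, b, c)\<close> to
  \<open>(c, b * c, a * c)\<close>. Their images under \<open>\<zeta>'\<close> begin with \<open>(c * a) * b\<close> and \<open>(c * b) * a\<close>
  respectively, which differ by \<open>4 (b - a)\<close>.
\<close>

lemma zeta_not_inner:
  assumes n: "n \<ge> 3" and k: "k \<ge> 1" and \<zeta>: "is_zeta n k k \<zeta>"
    and desc: "descends_to (UV n k) (MVB n k) (q_map n k) \<zeta> \<zeta>'"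
  shows "out_class (MVB n k) \<zeta>' \<noteq> \<one>\<^bsub>Out (MVB n k)\<^esub>"
proof
  assume one: "out_class (MVB n k) \<zeta>' = \<one>\<^bsub>Out (MVB n k)\<^esub>"
  let ?B = "BijGroup (UNIV :: (nat \<Rightarrow> int) set)"
  interpret q: group_hom "UV n k" "MVB n k" "q_map n k" by (rule q_map_hom[OF k])
  obtain \<psi> where \<psi>: "\<psi> \<in> hom (MVB n k) ?B"
    "\<And>i. i \<in> {1..<n} \<Longrightarrow> \<psi> (q_map n k (uv_rho n k i)) = act_at i prod.swap"
    "\<And>i. i \<in> {1..<n} \<Longrightarrow> \<psi> (q_map n k (uv_sigma n k i k)) = act_at i dihedral"
    using MVB_dihedral_action[OF k] by blast
  interpret \<psi>: group_hom "MVB n k" ?B \<psi>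
    using \<psi>(1) group_BijGroup q.H.is_group by (simp add: group_hom_def group_hom_axioms_def)
  have auto: "\<zeta>' \<in> auto (MVB n k)" using desc by (simp add: descends_to_def)
  interpret \<zeta>': group_hom "MVB n k" "MVB n k" \<zeta>'
    using auto by unfold_locales (simp add: auto_def)
  obtain g where g: "g \<in> carrier (MVB n k)"
    "\<And>x. x \<in> carrier (MVB n k) \<Longrightarrow> \<zeta>' x = g \<otimes>\<^bsub>MVB n k\<^esub> x \<otimes>\<^bsub>MVB n k\<^esub> inv\<^bsub>MVB n k\<^esub> g"
    by (rule out_class_eq_oneD[OF group_MVB auto one]) blast
  define r s where "r i = q_map n k (uv_rho n k i)" and "s i = q_map n k (uv_sigma n k i k)" for i
  have I: "1 \<in> {1..<n}" "2 \<in> {1..<n}" using n by auto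
  have c: "r i \<in> carrier (MVB n k)" "s i \<in> carrier (MVB n k)" if "i \<in> {1..<n}" for i
    using that k by (auto simp: r_def s_def)
  have \<zeta>r: "\<zeta>' (r i) = r i" and \<zeta>s: "\<zeta>' (s i) = r i \<otimes>\<^bsub>MVB n k\<^esub> s i \<otimes>\<^bsub>MVB n k\<^esub> r i"
    if "i \<in> {1..<n}" for i
    using that \<zeta> desc k by (auto simp: r_def s_def descends_to_def is_zeta_def)
  note bij = bij_act_at[OF bij_swap] bij_act_at[OF bij_dihedral]
  define u v where "u = s 1 \<otimes>\<^bsub>MVB n k\<^esub> s 2 \<otimes>\<^bsub>MVB n k\<^esub> r 1"
    and "v = r 2 \<otimes>\<^bsub>MVB n k\<^esub> s 1 \<otimes>\<^bsub>MVB n k\<^esub> s 2"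
  have uv: "u \<in> carrier (MVB n k)" "v \<in> carrier (MVB n k)"
    using c I by (auto simp: u_def v_def)
  have \<psi>r: "\<psi> (r i) = act_at i prod.swap" and \<psi>s: "\<psi> (s i) = act_at i dihedral"
    if "i \<in> {1..<n}" for i
    using that \<psi>(2,3) by (simp_all add: r_def s_def)
  have "\<psi> u = \<psi> v"
    unfolding u_def v_def using I c
    by (simp add: \<psi>r \<psi>s BijGroup_UNIV_simps bij bij_comp)
      (auto simp: act_at_def dihedral_def fun_eq_iff numeral_2_eq_2)
  then have "\<psi> (\<zeta>' u) = \<psi> (\<zeta>' v)"
    using g uv by simp
  moreover have "\<psi> (\<zeta>' u) = act_at 1 prod.swap \<circ> act_at 1 dihedral \<circ> act_at 1 prod.swap
      \<circ> (act_at 2 prod.swap \<circ> act_at 2 dihedral \<circ> act_at 2 prod.swap) \<circ> act_at 1 prod.swap"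
    unfolding u_def using I c
    by (simp add: \<zeta>r \<zeta>s \<psi>r \<psi>s BijGroup_UNIV_simps bij bij_comp)
  moreover have "\<psi> (\<zeta>' v) = act_at 2 prod.swap
      \<circ> (act_at 1 prod.swap \<circ> act_at 1 dihedral \<circ> act_at 1 prod.swap)
      \<circ> (act_at 2 prod.swap \<circ> act_at 2 dihedral \<circ> act_at 2 prod.swap)"
    unfolding v_def using I c
    by (simp add: \<zeta>r \<zeta>s \<psi>r \<psi>s BijGroup_UNIV_simps bij bij_comp)
  \<comment> \<open>The colouring \<open>(a, b, c) = (1, 0, 0)\<close> separates the two: first entries \<open>-2\<close> and \<open>2\<close>.\<close>
  ultimately have "\<psi> (\<zeta>' u) (\<lambda>i. if i = 1 then 1 else 0) 1 = \<psi> (\<zeta>' v) (\<lambda>i. if i = 1 then 1 else 0) 1"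
    by simp
  then show False
    unfolding \<open>\<psi> (\<zeta>' u) = _ \<circ> _\<close> \<open>\<psi> (\<zeta>' v) = _ \<circ> _\<close>
    by (simp add: act_at_def dihedral_def)
qed

theorem corollary2p3:
  fixes n k :: nat
    and \<theta> :: "uv_gen word set \<Rightarrow> uv_gen word set"
    and \<zeta> :: "nat \<Rightarrow> uv_gen word set \<Rightarrow> uv_gen word set"
  assumes "n \<ge> 3" and "k \<ge> 1"
    and "is_theta n k \<theta>"
    and "\<And>l. l \<in> {1..k} \<Longrightarrow> is_zeta n k l (\<zeta> l)"
  shows "\<exists>\<theta>' \<zeta>'.
      descends_to (UV n k) (MVB n k) (q_map n k) \<theta> \<theta>'
    \<and> (\<forall>l\<in>{1..k}. descends_to (UV n k) (MVB n k) (q_map n k) (\<zeta> l) (\<zeta>' l))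
    \<and> (\<forall>\<alpha>\<in>insert \<theta>' (\<zeta>' ` {1..k}). involutive_on (carrier (MVB n k)) \<alpha>)
    \<and> (\<forall>\<alpha>\<in>insert \<theta>' (\<zeta>' ` {1..k}). \<forall>\<beta>\<in>insert \<theta>' (\<zeta>' ` {1..k}).
          commute_on (carrier (MVB n k)) \<alpha> \<beta>)
    \<and> subgroup_generated (Out (MVB n k)) {out_class (MVB n k) \<theta>', out_class (MVB n k) (\<zeta>' k)}
        \<cong> integer_mod_group 2 \<times>\<times> integer_mod_group 2"
  proof -
  interpret q: group_hom "UV n k" "MVB n k" "q_map n k" by (rule q_map_hom[OF assms(2)])
  interpret A: group "AutoGroup (MVB n k)" by (rule q.H.AutoGroup)
  interpret O: group "Out (MVB n k)" by (rule group_Out[OF group_MVB])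
  interpret out: group_hom "AutoGroup (MVB n k)" "Out (MVB n k)" "out_class (MVB n k)"
    using out_class_hom[OF group_MVB] by unfold_locales
  obtain \<theta>' where \<theta>': "descends_to (UV n k) (MVB n k) (q_map n k) \<theta> \<theta>'"
      "involutive_on (carrier (MVB n k)) \<theta>'"
    using theta_descends[OF assms(2,3)] by blast
  have "\<forall>l\<in>{1..k}. \<exists>\<alpha>'. descends_to (UV n k) (MVB n k) (q_map n k) (\<zeta> l) \<alpha>'
      \<and> involutive_on (carrier (MVB n k)) \<alpha>'"
    using zeta_descends[OF assms(2) _ assms(4)] by blast
  then obtain \<zeta>' where \<zeta>':
    "\<And>l. l \<in> {1..k} \<Longrightarrow> descends_to (UV n k) (MVB n k) (q_map n k) (\<zeta> l) (\<zeta>' l)"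
    "\<And>l. l \<in> {1..k} \<Longrightarrow> involutive_on (carrier (MVB n k)) (\<zeta>' l)"
    by (metis bchoice)
  have \<theta>\<zeta>: "commute_on (carrier (MVB n k)) \<theta>' (\<zeta>' l)" if "l \<in> {1..k}" for l
    using commute_on_descends[OF assms(2) theta_zeta_commute \<theta>'(1) \<zeta>'(1)] assms(3,4) that
    by blast
  have \<zeta>\<zeta>: "commute_on (carrier (MVB n k)) (\<zeta>' l) (\<zeta>' m)" if "l \<in> {1..k}" "m \<in> {1..k}" for l m
    using commute_on_descends[OF assms(2) zeta_zeta_commute \<zeta>'(1) \<zeta>'(1)] assms(4) that
    by blast
  have kk: "k \<in> {1..k}" using assms(2) by simp
  let ?a = "out_class (MVB n k) \<theta>'" and ?b = "out_class (MVB n k) (\<zeta>' k)"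
  have auto: "\<theta>' \<in> auto (MVB n k)" "\<zeta>' k \<in> auto (MVB n k)"
    using \<theta>'(1) \<zeta>'(1)[OF kk] by (simp_all add: descends_to_def)
  have square: "out_class (MVB n k) \<alpha> \<otimes>\<^bsub>Out (MVB n k)\<^esub> out_class (MVB n k) \<alpha> = \<one>\<^bsub>Out (MVB n k)\<^esub>"
    if "\<alpha> \<in> auto (MVB n k)" "involutive_on (carrier (MVB n k)) \<alpha>" for \<alpha>
  proof -
    have "\<alpha> \<otimes>\<^bsub>AutoGroup (MVB n k)\<^esub> \<alpha> = \<one>\<^bsub>AutoGroup (MVB n k)\<^esub>"
      using that
      by (auto simp: AutoGroup_mult AutoGroup_one compose_def involutive_on_def intro!: restrict_ext)
    then show ?thesis
      using that(1) by (simp add: AutoGroup_carrier flip: out.hom_mult)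
  qed
  have "\<theta>' \<otimes>\<^bsub>AutoGroup (MVB n k)\<^esub> \<zeta>' k = \<zeta>' k \<otimes>\<^bsub>AutoGroup (MVB n k)\<^esub> \<theta>'"
    using auto \<theta>\<zeta>[OF kk]
    by (auto simp: AutoGroup_mult compose_def commute_on_def intro!: restrict_ext)
  then have comm: "?a \<otimes>\<^bsub>Out (MVB n k)\<^esub> ?b = ?b \<otimes>\<^bsub>Out (MVB n k)\<^esub> ?a"
    using auto by (simp add: AutoGroup_carrier flip: out.hom_mult)
  obtain \<epsilon> where \<epsilon>: "\<epsilon> \<in> hom (MVB n k) integer_group"
    "\<And>i. i \<in> {1..<n} \<Longrightarrow> \<epsilon> (q_map n k (uv_rho n k i)) = 0"
    "\<And>i. i \<in> {1..<n} \<Longrightarrow> \<epsilon> (q_map n k (uv_sigma n k i k)) = 1"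
    using MVB_sigma_exponent[OF assms(2)] by blast
  interpret \<epsilon>: group_hom "MVB n k" integer_group \<epsilon>
    using \<epsilon>(1) group_MVB by (simp add: group_hom_def group_hom_axioms_def)
  have 1: "1 \<in> {1..<n}" using assms(1) by simp
  let ?r = "q_map n k (uv_rho n k 1)" and ?s = "q_map n k (uv_sigma n k 1 k)"
  have c: "?r \<in> carrier (MVB n k)" "?s \<in> carrier (MVB n k)" using 1 kk by auto
  have "\<theta>' ?s = inv\<^bsub>MVB n k\<^esub> ?s"
    using \<theta>'(1) assms(3) 1 kk by (simp add: descends_to_def is_theta_def)
  then have \<epsilon>\<theta>: "\<epsilon> (\<theta>' ?s) = - 1" using \<epsilon>(3)[OF 1] c by simp
  have "\<zeta>' k ?s = ?r \<otimes>\<^bsub>MVB n k\<^esub> ?s \<otimes>\<^bsub>MVB n k\<^esub> ?r"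
    using \<zeta>'(1)[OF kk] assms(4)[OF kk] 1 kk by (simp add: descends_to_def is_zeta_def)
  then have \<epsilon>\<zeta>: "\<epsilon> (\<zeta>' k ?s) = 1" using \<epsilon>(2,3)[OF 1] c by simp
  have "?a \<noteq> ?b"
    using integer_hom_out_class_invariant[OF group_MVB \<epsilon>(1) auto _ c(2)] \<epsilon>\<theta> \<epsilon>\<zeta> by auto
  moreover have "?a \<noteq> \<one>\<^bsub>Out (MVB n k)\<^esub>"
  proof
    assume "?a = \<one>\<^bsub>Out (MVB n k)\<^esub>"
    then have "?a = out_class (MVB n k) \<one>\<^bsub>AutoGroup (MVB n k)\<^esub>" by simp
    from integer_hom_out_class_invariant[OF group_MVB \<epsilon>(1) auto(1) _ this c(2)]
    have "\<epsilon> (\<theta>' ?s) = \<epsilon> ?s"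
      using A.one_closed c(2) by (simp add: AutoGroup_carrier AutoGroup_one)
    then show False using \<epsilon>\<theta> \<epsilon>(3)[OF 1] by simp
  qed
  moreover have "?b \<noteq> \<one>\<^bsub>Out (MVB n k)\<^esub>"
    by (rule zeta_not_inner[OF assms(1,2) assms(4)[OF kk] \<zeta>'(1)[OF kk]])
  ultimately have Klein: "subgroup_generated (Out (MVB n k)) {?a, ?b}
      \<cong> integer_mod_group 2 \<times>\<times> integer_mod_group 2"
    using auto square[OF auto(1) \<theta>'(2)] square[OF auto(2) \<zeta>'(2)[OF kk]] comm
    by (intro O.commuting_involutions_generate_Klein_four) (auto simp flip: AutoGroup_carrier)
  have sym: "commute_on S \<beta> \<alpha>" if "commute_on S \<alpha> \<beta>" for S :: "mv_gen word set set" and \<alpha> \<beta>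
    using that by (simp add: commute_on_def)
  have refl: "commute_on S \<alpha> \<alpha>" for S :: "mv_gen word set set" and \<alpha>
    by (simp add: commute_on_def)
  show ?thesis
    using \<theta>' \<zeta>' \<theta>\<zeta> \<zeta>\<zeta> Klein
    by (intro exI[of _ \<theta>'] exI[of _ \<zeta>'] conjI) (auto intro: sym refl)
qed

end
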